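(* Let $\mathcal G$ be a $2$-step solvable $\mathrm{MD}_{n-2}(n)$-algebra with $n=\dim\mathcal G\ge6$. Then $\mathcal G\cong\mathbb R\oplus\mathfrak s_{5,45}$ (in particular $n=6$), where $\mathfrak s_{5,45}$ is the Lie algebra with basis $\{x_1,x_2,y_1,y_2,z\}$ and nonzero brackets $[x_1,y_1]=y_1$, $[x_1,y_2]=y_2$, $[x_1,z]=2z$, $[x_2,y_1]=y_2$, $[x_2,y_2]=-y_1$, $[y_1,y_2]=z$.
   Context: All Lie algebras are finite-dimensional over $\mathbb R$. $\mathcal G^0=\mathcal G$, $\mathcal G^i=[\mathcal G^{i-1},\mathcal G^{i-1}]$; $\mathcal G$ is $2$-step solvable if $\mathcal G^2$ is commutative and nonzero. An $\mathrm{MD}_k(n)$-algebra is an $n$-dimensional real solvable Lie algebra all of whose non-trivial coadjoint orbits (for its connected simply connected Lie group; $\dim\Omega_F=\operatorname{rank}(F([x_i,x_j]))$ for a basis $\{x_i\}$, non-trivial iff $F|_{\mathcal G^1}\ne0$) have dimension $k$. $\mathbb R\oplus\mathfrak s_{5,45}$ is the Lie algebra direct sum with a $1$-dimensional abelian algebra. *)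

theory Defs
  imports "HOL-Analysis.Analysis"
begin

text \<open>A finite-dimensional real Lie algebra is modelled as a finite-dimensional real
vector space (a type of class euclidean_space; its inner product is irrelevant)
together with a bracket operation.\<close>

definition lie_algebra :: "('a::euclidean_space \<Rightarrow> 'a \<Rightarrow> 'a) \<Rightarrow> bool" where
  "lie_algebra br \<longleftrightarrow> bilinear br \<and> (\<forall>x. br x x = 0) \<and>
     (\<forall>x y z. br x (br y z) + br y (br z x) + br z (br x y) = 0)"

fun derived :: "('a::euclidean_space \<Rightarrow> 'a \<Rightarrow> 'a) \<Rightarrow> nat \<Rightarrow> 'a set" where
  "derived br 0 = UNIV"
| "derived br (Suc i) = span {br x y | x y. x \<in> derived br i \<and> y \<in> derived br i}"

definition solvable_lie :: "('a::euclidean_space \<Rightarrow> 'a \<Rightarrow> 'a) \<Rightarrow> bool" where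
  "solvable_lie br \<longleftrightarrow> (\<exists>i. derived br i = {0})"

definition two_step_solvable :: "('a::euclidean_space \<Rightarrow> 'a \<Rightarrow> 'a) \<Rightarrow> bool" where
  "two_step_solvable br \<longleftrightarrow>
     (\<forall>x\<in>derived br 2. \<forall>y\<in>derived br 2. br x y = 0) \<and> derived br 2 \<noteq> {0}"

text \<open>Dimension of the coadjoint orbit of F: the rank of the matrix (F [b_i, b_j])
over the basis, i.e. the dimension of the column space of that matrix.\<close>
definition coadj_orbit_dim :: "('a::euclidean_space \<Rightarrow> 'a \<Rightarrow> 'a) \<Rightarrow> ('a \<Rightarrow> real) \<Rightarrow> nat" where
  "coadj_orbit_dim br F = dim (range (\<lambda>x. \<Sum>b\<in>Basis. F (br x b) *\<^sub>R b))"

text \<open>MD_k(n)-algebra (n = DIM('a)): a solvable real Lie algebra all of whose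
non-trivial coadjoint orbits (F linear with F not vanishing on G^1) have dimension k.\<close>
definition MD_algebra :: "nat \<Rightarrow> ('a::euclidean_space \<Rightarrow> 'a \<Rightarrow> 'a) \<Rightarrow> bool" where
  "MD_algebra k br \<longleftrightarrow> lie_algebra br \<and> solvable_lie br \<and>
     (\<forall>F. linear F \<longrightarrow> (\<exists>x\<in>derived br 1. F x \<noteq> 0) \<longrightarrow> coadj_orbit_dim br F = k)"

text \<open>The Lie algebra R (+) s_{5,45} on real^6: coordinate 0 is the central R summand,
coordinates 1,2,3,4,5 correspond to x1,x2,y1,y2,z, with nonzero brackets
[x1,y1]=y1, [x1,y2]=y2, [x1,z]=2z, [x2,y1]=y2, [x2,y2]=-y1, [y1,y2]=z.\<close>
definition R_s545_br :: "real^6 \<Rightarrow> real^6 \<Rightarrow> real^6" where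
  "R_s545_br u v = (\<chi> k.
     if k = 3 then (u$1 * v$3 - u$3 * v$1) - (u$2 * v$4 - u$4 * v$2)
     else if k = 4 then (u$1 * v$4 - u$4 * v$1) + (u$2 * v$3 - u$3 * v$2)
     else if k = 5 then 2 * (u$1 * v$5 - u$5 * v$1) + (u$3 * v$4 - u$4 * v$3)
     else 0)"

definition lie_isomorphic_to_R_s545 :: "('a::euclidean_space \<Rightarrow> 'a \<Rightarrow> 'a) \<Rightarrow> bool" where
  "lie_isomorphic_to_R_s545 br \<longleftrightarrow>
     (\<exists>f :: 'a \<Rightarrow> real^6. linear f \<and> bij f \<and> (\<forall>x y. f (br x y) = R_s545_br (f x) (f y)))"

end

theory Submission
  imports Defs "HOL-Computational_Algebra.Fundamental_Theorem_Algebra"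
begin

text \<open>
  Write \<open>G1\<close> and \<open>G2\<close> for the first two derived algebras. A functional vanishing on an ideal \<open>I\<close> with
  \<open>G2 \<subseteq> I \<subset> G1\<close> has \<open>I\<close> in the kernel of its alternating form, so \<open>dim I \<le> 2\<close>. The operators \<open>ad x\<close>
  commute on \<open>G1/G2\<close>, hence an irreducible quotient of it has dimension at most 2 (this is where the
  ground field enters), and \<open>dim G1 \<le> 4\<close>. Small cases are then excluded until \<open>G1\<close> is the
  three-dimensional Heisenberg algebra with centre \<open>G2\<close>. The centralizer \<open>C\<close> of \<open>G1\<close> satisfies
  \<open>[G, C] \<subseteq> G2\<close>, so \<open>dim C \<le> 2\<close>, and the elements acting trivially on \<open>G1/G2\<close> lie in \<open>C + G1\<close>, a
  space of dimension at most 4. If \<open>n \<ge> 6\<close>, this leaves only \<open>n = 6\<close> with \<open>G\<close> acting on \<open>G1/G2\<close> as the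
  complex numbers act on themselves. The basis of the model is built from elements acting as
  \<open>1\<close> and \<open>i\<close>, made exact by using that the former acts on \<open>G2\<close> as multiplication by 2.
\<close>

section \<open>Linear algebra\<close>

text \<open>Rank-nullity on a subspace: the orthogonal complement \<open>?P\<close> of the kernel
  inside \<open>S\<close> is mapped injectively and has the same image as \<open>S\<close>.\<close>

lemma dim_kernel_image:
  fixes f :: "'a::euclidean_space \<Rightarrow> 'b::euclidean_space"
  assumes f: "linear f" and S: "subspace S"
  shows "dim {s \<in> S. f s = 0} + dim (f ` S) = dim S"
proof -
  interpret linear f by (rule f)
  let ?K = "{s \<in> S. f s = 0}" and ?P = "{y \<in> S. \<forall>x\<in>{s \<in> S. f s = 0}. orthogonal x y}"
  have K: "subspace ?K"
    using S by (auto simp: subspace_def add scale)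
  have P: "subspace ?P"
    using S by (auto simp: subspace_def orthogonal_def inner_right_distrib)
  have dims: "dim ?P + dim ?K = dim S"
    by (rule dim_subspace_orthogonal_to_vectors[OF K S]) auto
  have "inj_on f ?P"
  proof (rule inj_onI)
    fix x y assume xy: "x \<in> ?P" "y \<in> ?P" "f x = f y"
    have "x - y \<in> ?P" using subspace_diff[OF P] xy by blast
    moreover have "x - y \<in> ?K" using calculation xy by (auto simp: diff)
    ultimately have "orthogonal (x - y) (x - y)" by blast
    then show "x = y" by (simp add: orthogonal_self)
  qed
  then have "dim (f ` ?P) = dim ?P"
    using P by (intro dim_image_eq[OF f]) (simp add: span_eq_iff[THEN iffD2])
  moreover have "f ` S = f ` ?P"
  proof
    show "f ` S \<subseteq> f ` ?P"
    proof
      fix w assume "w \<in> f ` S"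
      then obtain s where s: "s \<in> S" "w = f s" by blast
      obtain y z where yz: "y \<in> span ?K" "\<And>w. w \<in> span ?K \<Longrightarrow> orthogonal z w" "s = y + z"
        using orthogonal_subspace_decomp_exists by blast
      have y: "y \<in> ?K" using yz K by (simp add: span_eq_iff[THEN iffD2])
      have "z = s - y" using yz by simp
      then have "z \<in> S" using subspace_diff[OF S] s y by auto
      moreover have "\<forall>x\<in>?K. orthogonal x z"
        using yz(2) span_base orthogonal_commute by metis
      ultimately have "z \<in> ?P" by blast
      moreover have "w = f z" using s yz(3) y by (simp add: add)
      ultimately show "w \<in> f ` ?P" by blast
    qed
  qed auto
  ultimately show ?thesis using dims by simp
qed

text \<open>Rank-nullity for the map from \<open>S\<close> to the quotient by \<open>Z\<close>,
  without forming the quotient: its kernel is the preimage of \<open>Z\<close>, and its image is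
  replaced by the sum of the image with \<open>Z\<close>.\<close>

lemma dim_preimage_image:
  fixes f :: "'a::euclidean_space \<Rightarrow> 'b::euclidean_space"
  assumes f: "linear f" and S: "subspace S" and Z: "subspace Z"
  shows "dim {s \<in> S. f s \<in> Z} + dim {f s + z | s z. s \<in> S \<and> z \<in> Z} = dim S + dim Z"
proof -
  interpret linear f by (rule f)
  let ?T = "{s \<in> S. f s \<in> Z}"
  have T: "subspace ?T"
    using S Z by (auto simp: subspace_def add scale)
  have "dim {s \<in> ?T. f s = 0} + dim (f ` ?T) = dim ?T"
    by (rule dim_kernel_image[OF f T])
  moreover have "{s \<in> ?T. f s = 0} = {s \<in> S. f s = 0}"
    using subspace_0[OF Z] by auto
  moreover have "f ` ?T = f ` S \<inter> Z" by auto
  moreover have "dim {s \<in> S. f s = 0} + dim (f ` S) = dim S"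
    by (rule dim_kernel_image[OF f S])
  moreover have "dim {x + y | x y. x \<in> f ` S \<and> y \<in> Z} + dim (f ` S \<inter> Z) = dim (f ` S) + dim Z"
    by (rule dim_sums_Int) (use linear_subspace_image[OF f S] Z in auto)
  moreover have "{x + y | x y. x \<in> f ` S \<and> y \<in> Z} = {f s + z | s z. s \<in> S \<and> z \<in> Z}"
    by blast
  ultimately show ?thesis by simp
qed

lemma linear_image_span_subset:
  assumes "linear f" "\<And>x. x \<in> B \<Longrightarrow> f x \<in> S" "subspace S" "x \<in> span B"
  shows "f x \<in> S"
proof -
  have "f ` span B = span (f ` B)" by (rule linear_span_image[OF assms(1), symmetric])
  also have "\<dots> \<subseteq> S" using assms by (intro span_minimal) auto
  finally show ?thesis using assms(4) by blast
qed

lemma subspace_span_insert: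
  fixes S T :: "'a::euclidean_space set"
  assumes "subspace S" "subspace T" "S \<subseteq> T" "v \<in> T" "v \<notin> S" "dim T \<le> dim S + 1"
  shows "T = span (insert v S)"
proof -
  have "dim (span (insert v S)) = dim S + 1"
    using assms by (simp add: dim_insert span_eq_iff[THEN iffD2])
  moreover have "span (insert v S) \<subseteq> T"
    using assms by (intro span_minimal) auto
  ultimately have "span (insert v S) = T"
    using assms(2,6) by (intro subspace_dim_equal[OF subspace_span]) simp_all
  then show ?thesis ..
qed

section \<open>Polynomials in a linear operator\<close>

definition poly_op :: "('a \<Rightarrow> 'a) \<Rightarrow> real poly \<Rightarrow> 'a \<Rightarrow> 'a::real_vector" where
  "poly_op T p v = (\<Sum>i\<le>degree p. coeff p i *\<^sub>R (T ^^ i) v)"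

lemma poly_op_bound:
  assumes "degree p \<le> n"
  shows "poly_op T p v = (\<Sum>i\<le>n. coeff p i *\<^sub>R (T ^^ i) v)"
  unfolding poly_op_def
  by (rule sum.mono_neutral_left) (use assms in \<open>auto simp: coeff_eq_0\<close>)

lemma poly_op_pCons:
  assumes "linear T"
  shows "poly_op T (pCons a p) v = a *\<^sub>R v + T (poly_op T p v)"
proof -
  interpret linear T by (rule assms)
  have "poly_op T (pCons a p) v = (\<Sum>i\<le>Suc (degree p). coeff (pCons a p) i *\<^sub>R (T ^^ i) v)"
    by (rule poly_op_bound) (rule degree_pCons_le)
  also have "\<dots> = a *\<^sub>R v + (\<Sum>i\<le>degree p. coeff p i *\<^sub>R T ((T ^^ i) v))"
    by (simp add: sum.atMost_Suc_shift del: sum.atMost_Suc)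
  also have "\<dots> = a *\<^sub>R v + T (poly_op T p v)"
    by (simp add: poly_op_def sum scale)
  finally show ?thesis .
qed

lemma poly_op_0 [simp]: "poly_op T 0 v = 0"
  by (simp add: poly_op_def)

lemma poly_op_add: "poly_op T (p + q) v = poly_op T p v + poly_op T q v"
proof -
  let ?n = "max (degree p) (degree q)"
  have "degree (p + q) \<le> ?n" by (rule degree_add_le) auto
  then show ?thesis
    by (simp add: poly_op_bound[of _ ?n] scaleR_left_distrib sum.distrib)
qed

lemma poly_op_smult: "poly_op T (smult c p) v = c *\<^sub>R poly_op T p v"
  by (simp add: poly_op_bound[of "smult c p" "degree p"] degree_smult_le scaleR_sum_right poly_op_def)

lemma poly_op_mult:
  assumes "linear T"
  shows "poly_op T (p * q) v = poly_op T p (poly_op T q v)"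
proof (induction p)
  case 0
  then show ?case by simp
next
  case (pCons a p)
  then show ?case
    by (simp add: poly_op_add poly_op_smult poly_op_pCons[OF assms])
qed

text \<open>The \<open>DIM('a) + 1\<close> iterates of \<open>v\<close> are dependent, and a
  dependence supplies the coefficients of \<open>p\<close>.\<close>

lemma linear_poly_op_annihilates:
  fixes v :: "'a::euclidean_space"
  assumes "linear T"
  shows "\<exists>p. p \<noteq> 0 \<and> poly_op T p v = 0"
proof -
  let ?n = "DIM('a)"
  let ?f = "\<lambda>i. (T ^^ i) v"
  show ?thesis
  proof (cases "inj_on ?f {..?n}")
    case True
    then have "card (?f ` {..?n}) > ?n" by (simp add: card_image)
    then have "dependent (?f ` {..?n})"
      using independent_bound_general dim_subset_UNIV
      by (metis independent_card_le linorder_not_le)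
    then obtain u where u: "\<exists>x\<in>?f ` {..?n}. u x \<noteq> 0" "(\<Sum>x\<in>?f ` {..?n}. u x *\<^sub>R x) = 0"
      using dependent_finite[of "?f ` {..?n}"] by auto
    let ?p = "\<Sum>i\<le>?n. monom (u (?f i)) i"
    have c: "coeff ?p j = (if j \<le> ?n then u (?f j) else 0)" for j
      by (simp add: coeff_sum)
    have deg: "degree ?p \<le> ?n"
      by (rule degree_le) (simp add: c)
    have "?p \<noteq> 0"
    proof
      assume "?p = 0"
      then have "\<forall>j\<le>?n. u (?f j) = 0" using c by (metis coeff_0)
      with u show False by auto
    qed
    moreover have "poly_op T ?p v = 0"
      using u(2) by (simp add: poly_op_bound[OF deg] c sum.reindex[OF True])
    ultimately show ?thesis by blast
  next
    \<comment> \<open>Dependence is a property of sets, so coinciding iterates need a polynomial of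
      their own, \<open>X^i - X^j\<close>.\<close>
    case False
    then obtain i j where ij: "i \<noteq> j" "?f i = ?f j" by (auto simp: inj_on_def)
    have m: "poly_op T (monom c k) v = c *\<^sub>R ?f k" for c k
      by (subst poly_op_bound[of _ k])
         (auto simp: degree_monom_le sum.remove[of _ k] intro: sum.neutral)
    have "monom 1 i + monom (-1) j \<noteq> (0 :: real poly)"
      using ij(1) by (metis coeff_0 coeff_add coeff_monom add.right_neutral one_neq_zero)
    moreover have "poly_op T (monom 1 i + monom (-1) j) v = 0"
      by (simp add: poly_op_add m ij(2))
    ultimately show ?thesis by blast
  qed
qed

text \<open>A complex root \<open>z\<close> gives the factor: linear if \<open>z\<close> is real,
  otherwise the quadratic with roots \<open>z\<close> and its conjugate, written as
  \<open>(X - a)^2 + b^2\<close>.\<close>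

lemma real_poly_factor_degree_le_2:
  fixes p :: "real poly"
  assumes "degree p > 0"
  shows "(\<exists>t q. p = [:-t, 1:] * q) \<or>
         (\<exists>a b q. b \<noteq> 0 \<and> p = [:a\<^sup>2 + b\<^sup>2, -2 * a, 1:] * q)"
proof -
  let ?c = "map_poly complex_of_real"
  have "degree (?c p) > 0" using assms by (simp add: degree_map_poly)
  then have "\<not> constant (poly (?c p))"
    by (simp add: constant_degree)
  then obtain z where z: "poly (?c p) z = 0"
    using fundamental_theorem_of_algebra by blast
  have ev: "poly (?c (r1 * r2 + r3)) z = poly (?c r1) z * poly (?c r2) z + poly (?c r3) z" for r1 r2 r3
  proof -
    have "?c (r1 * r2 + r3) = ?c r1 * ?c r2 + ?c r3"
      by (rule poly_eqI) (simp add: coeff_map_poly coeff_mult)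
    then show ?thesis by simp
  qed
  show ?thesis
  proof (cases "Im z = 0")
    case True
    then have "z = of_real (Re z)" by (simp add: complex_eq_iff)
    moreover have "poly (?c p) (of_real x) = of_real (poly p x)" for x
      by (induction p) (simp_all add: map_poly_pCons)
    ultimately have "poly p (Re z) = 0" using z by (metis of_real_eq_0_iff)
    then show ?thesis by (metis dvd_def poly_eq_0_iff_dvd)
  next
    case False
    let ?d = "[:(Re z)\<^sup>2 + (Im z)\<^sup>2, -2 * Re z, 1:]"
    have dz: "poly (?c ?d) z = 0"
      by (simp add: map_poly_pCons complex_eq_iff power2_eq_square algebra_simps)
    \<comment> \<open>The remainder \<open>e + f X\<close> vanishes at the non-real
      \<open>z\<close>; the imaginary part gives \<open>f = 0\<close>, and then
      \<open>e = 0\<close>.\<close>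
    let ?r = "p mod ?d"
    have p: "?d * (p div ?d) + ?r = p" by (rule mult_div_mod_eq)
    have rz: "poly (?c ?r) z = 0"
      using ev[of ?d "p div ?d" ?r] unfolding p z dz by simp
    have "degree ?r < 2 \<or> ?r = 0"
      using degree_mod_less'[of ?d p] by (auto)
    then have "degree ?r \<le> 1" by auto
    then have "?r = [:coeff ?r 0, coeff ?r 1:]"
      by (intro poly_eqI) (auto simp: coeff_pCons coeff_eq_0 split: nat.split)
    then obtain e f where r: "?r = [:e, f:]" by blast
    have "e = 0 \<and> f = 0" using rz False unfolding r
      by (auto simp: map_poly_pCons complex_eq_iff)
    then have "?r = 0" using r by simp
    then have "p = ?d * (p div ?d)" using p by (metis add.right_neutral)
    then show ?thesis using False by blast
  qed
qed

section \<open>Irreducible commuting families of operators on a quotient\<close>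

text \<open>The irreducible module is the quotient of \<open>A\<close> by \<open>M\<close>. It is
  never formed: identities on it are memberships in \<open>M\<close>, and its submodules are the
  invariant subspaces between \<open>M\<close> and \<open>A\<close>.\<close>

locale irreducible_commuting =
  fixes T :: "'i \<Rightarrow> 'a::euclidean_space \<Rightarrow> 'a" and A M :: "'a set"
  assumes linear_T: "linear (T i)"
    and subspace_A: "subspace A" and subspace_M: "subspace M"
    and M_subset: "M \<subseteq> A" and M_neq: "M \<noteq> A"
    and T_A: "a \<in> A \<Longrightarrow> T i a \<in> A" and T_M: "a \<in> M \<Longrightarrow> T i a \<in> M"
    and T_commute: "a \<in> A \<Longrightarrow> T i (T j a) - T j (T i a) \<in> M"
    and irreducible: "subspace I \<Longrightarrow> M \<subseteq> I \<Longrightarrow> I \<subseteq> A \<Longrightarrow> (\<And>i a. a \<in> I \<Longrightarrow> T i a \<in> I) \<Longrightarrow> I = M \<or> I = A"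
begin

definition equivariant :: "('a \<Rightarrow> 'a) \<Rightarrow> bool" where
  "equivariant L \<longleftrightarrow> linear L \<and> (\<forall>a\<in>A. L a \<in> A) \<and> (\<forall>a\<in>M. L a \<in> M) \<and>
     (\<forall>i. \<forall>a\<in>A. T i (L a) - L (T i a) \<in> M)"

lemma equivariant_T: "equivariant (T i)"
  unfolding equivariant_def using linear_T T_A T_M T_commute by blast

lemma equivariant_scale: "equivariant (\<lambda>a. c *\<^sub>R a)"
  unfolding equivariant_def using subspace_A subspace_M linear_T
  by (auto simp: subspace_scale linear_scale subspace_0 intro: linear_scaleR)

lemma equivariant_comp:
  assumes "equivariant L" "equivariant K"
  shows "equivariant (\<lambda>a. L (K a))"
proof -
  have L: "linear L" and K: "linear K" using assms by (auto simp: equivariant_def)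
  have "T i (L (K a)) - L (K (T i a)) \<in> M" if "a \<in> A" for i a
  proof -
    have "T i (L (K a)) - L (T i (K a)) \<in> M" using assms that by (auto simp: equivariant_def)
    moreover have "L (T i (K a) - K (T i a)) \<in> M" using assms that by (auto simp: equivariant_def)
    ultimately have "T i (L (K a)) - L (T i (K a)) + L (T i (K a) - K (T i a)) \<in> M"
      by (rule subspace_add[OF subspace_M])
    then show ?thesis by (simp add: linear_diff[OF L])
  qed
  then show ?thesis
    using assms linear_compose[OF K L] by (auto simp: equivariant_def o_def)
qed

lemma equivariant_add:
  assumes "equivariant L" "equivariant K"
  shows "equivariant (\<lambda>a. L a + K a)"
proof -
  have "T i (L a + K a) - (L (T i a) + K (T i a)) \<in> M" if "a \<in> A" for i a
  proof -
    have "(T i (L a) - L (T i a)) + (T i (K a) - K (T i a)) \<in> M"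
      using assms that by (intro subspace_add[OF subspace_M]) (auto simp: equivariant_def)
    then show ?thesis by (simp add: linear_add[OF linear_T] algebra_simps)
  qed
  then show ?thesis
    using assms subspace_add[OF subspace_A] subspace_add[OF subspace_M]
    by (auto simp: equivariant_def intro: linear_compose_add)
qed

lemma equivariant_diff:
  assumes "equivariant L" "equivariant K"
  shows "equivariant (\<lambda>a. L a - K a)"
  using equivariant_add[OF assms(1) equivariant_comp[OF equivariant_scale[of "-1"] assms(2)]] by simp

text \<open>The vectors of \<open>A\<close> that \<open>L\<close> sends into \<open>M\<close> form
  an invariant subspace containing \<open>M\<close>; irreducibility makes it \<open>A\<close> once
  it contains a vector outside \<open>M\<close>.\<close>

lemma schur:
  assumes L: "equivariant L" and v: "v \<in> A" "v \<notin> M" "L v \<in> M" and a: "a \<in> A"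
  shows "L a \<in> M"
proof -
  let ?I = "{a \<in> A. L a \<in> M}"
  have lin: "linear L" using L by (simp add: equivariant_def)
  have sub: "subspace ?I"
    using subspace_A subspace_M
    by (auto simp: subspace_def linear_add[OF lin] linear_scale[OF lin] linear_0[OF lin])
  have inv: "T i a \<in> ?I" if "a \<in> ?I" for i a
  proof -
    have "T i (L a) - (T i (L a) - L (T i a)) \<in> M"
      by (rule subspace_diff[OF subspace_M T_M]) (use that L in \<open>auto simp: equivariant_def\<close>)
    then show ?thesis using that T_A by simp
  qed
  have "?I = M \<or> ?I = A"
    by (rule irreducible[OF sub]) (use L M_subset inv in \<open>auto simp: equivariant_def\<close>)
  then show ?thesis using v a by blast
qed

lemma poly_op_A: "a \<in> A \<Longrightarrow> poly_op (T i) p a \<in> A"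
  by (induction p) (auto simp: poly_op_pCons[OF linear_T] subspace_0 subspace_A
      intro!: subspace_add[OF subspace_A] subspace_scale[OF subspace_A] T_A)

text \<open>Descent on the degree: split off a factor \<open>d\<close> of degree 1 or 2,
  \<open>p = d * q\<close>. Either \<open>q\<close> already sends \<open>v\<close> into
  \<open>M\<close>, or the image of \<open>v\<close> under \<open>q\<close> is outside
  \<open>M\<close> and is sent into \<open>M\<close> by \<open>d\<close>.\<close>

lemma minimal_quadratic_vector:
  assumes "p \<noteq> 0" "v \<in> A" "v \<notin> M" "poly_op (T i) p v \<in> M"
  shows "\<exists>w\<in>A - M. (\<exists>t. T i w - t *\<^sub>R w \<in> M) \<or>
    (\<exists>a b. b \<noteq> 0 \<and> T i (T i w) - (2 * a) *\<^sub>R T i w + (a\<^sup>2 + b\<^sup>2) *\<^sub>R w \<in> M)"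
  using assms
proof (induction "degree p" arbitrary: p rule: less_induct)
  case less
  note lin = linear_T[of i]
  show ?case
  proof (cases "degree p = 0")
    case True
    then obtain c where c: "p = [:c:]" by (metis degree_eq_zeroE)
    then have "c \<noteq> 0" "c *\<^sub>R v \<in> M"
      using less.prems by (auto simp: poly_op_pCons[OF lin] linear_0[OF lin])
    then have "(1 / c) *\<^sub>R (c *\<^sub>R v) \<in> M" using subspace_scale[OF subspace_M] by blast
    then show ?thesis using \<open>c \<noteq> 0\<close> less.prems by simp
  next
    case False
    have reduce: ?thesis if pq: "p = d * q" "degree d > 0"
      and d: "\<And>w. poly_op (T i) d w \<in> M \<Longrightarrow> (\<exists>t. T i w - t *\<^sub>R w \<in> M) \<or>
        (\<exists>a b. b \<noteq> 0 \<and> T i (T i w) - (2 * a) *\<^sub>R T i w + (a\<^sup>2 + b\<^sup>2) *\<^sub>R w \<in> M)" for d q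
    proof (cases "poly_op (T i) q v \<in> M")
      case True
      have "d \<noteq> 0" "q \<noteq> 0" using pq less.prems by auto
      then have "degree q < degree p" using pq by (simp add: degree_mult_eq)
      then show ?thesis using less.hyps \<open>q \<noteq> 0\<close> less.prems True by blast
    next
      case False
      have "poly_op (T i) d (poly_op (T i) q v) \<in> M"
        using less.prems pq by (simp add: poly_op_mult[OF lin])
      then show ?thesis using d False poly_op_A less.prems by blast
    qed
    from real_poly_factor_degree_le_2[of p] False
    consider t q where "p = [:-t, 1:] * q"
      | a b q where "b \<noteq> 0" "p = [:a\<^sup>2 + b\<^sup>2, -2 * a, 1:] * q" by blast
    then show ?thesis
    proof cases
      case 1
      then show ?thesis
        by (rule reduce) (auto simp: poly_op_pCons[OF lin] linear_0[OF lin] algebra_simps intro!: exI[of _ t])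
    next
      case (2 a b q)
      show ?thesis
      proof (rule reduce[OF 2(2)])
        fix w assume "poly_op (T i) [:a\<^sup>2 + b\<^sup>2, -2 * a, 1:] w \<in> M"
        then have "T i (T i w) - (2 * a) *\<^sub>R T i w + (a\<^sup>2 + b\<^sup>2) *\<^sub>R w \<in> M"
          by (simp add: poly_op_pCons[OF lin] linear_0[OF lin] linear_diff[OF lin] linear_scale[OF lin] linear_add[OF lin] algebra_simps)
        then show "(\<exists>t. T i w - t *\<^sub>R w \<in> M) \<or>
            (\<exists>a b. b \<noteq> 0 \<and> T i (T i w) - (2 * a) *\<^sub>R T i w + (a\<^sup>2 + b\<^sup>2) *\<^sub>R w \<in> M)"
          using 2(1) by blast
      qed simp
    qed
  qed
qed

text \<open>Polynomials in \<open>T i\<close> are equivariant, so by \<open>schur\<close> an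
  equation modulo \<open>M\<close> at one vector outside \<open>M\<close> spreads to all of
  \<open>A\<close>.\<close>

lemma scalar_or_quadratic:
  obtains t where "\<And>a. a \<in> A \<Longrightarrow> T i a - t *\<^sub>R a \<in> M"
  | p q where "q \<noteq> 0" "\<And>a. a \<in> A \<Longrightarrow> T i (T i a) - (2 * p) *\<^sub>R T i a + (p\<^sup>2 + q\<^sup>2) *\<^sub>R a \<in> M"
proof -
  obtain v where v: "v \<in> A" "v \<notin> M" using M_subset M_neq by blast
  obtain r where r: "r \<noteq> 0" "poly_op (T i) r v = 0"
    using linear_poly_op_annihilates[OF linear_T] by blast
  then have "poly_op (T i) r v \<in> M" using subspace_0[OF subspace_M] by simp
  from minimal_quadratic_vector[OF r(1) v this]
  obtain w where w: "w \<in> A" "w \<notin> M" and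
    "(\<exists>t. T i w - t *\<^sub>R w \<in> M) \<or>
     (\<exists>a b. b \<noteq> 0 \<and> T i (T i w) - (2 * a) *\<^sub>R T i w + (a\<^sup>2 + b\<^sup>2) *\<^sub>R w \<in> M)" by blast
  then consider t where "T i w - t *\<^sub>R w \<in> M"
    | a b where "b \<noteq> 0" "T i (T i w) - (2 * a) *\<^sub>R T i w + (a\<^sup>2 + b\<^sup>2) *\<^sub>R w \<in> M" by blast
  then show ?thesis
  proof cases
    case 1
    have "T i a - t *\<^sub>R a \<in> M" if "a \<in> A" for a
      by (rule schur[where L = "\<lambda>a. T i a - t *\<^sub>R a", OF _ w 1 that])
        (intro equivariant_diff equivariant_T equivariant_scale)
    then show ?thesis using that(1) by blast
  next
    case (2 p q)
    have "T i (T i a) - (2 * p) *\<^sub>R T i a + (p\<^sup>2 + q\<^sup>2) *\<^sub>R a \<in> M" if "a \<in> A" for a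
      by (rule schur[where L = "\<lambda>a. T i (T i a) - (2 * p) *\<^sub>R T i a + (p\<^sup>2 + q\<^sup>2) *\<^sub>R a",
            OF _ w 2(2) that])
        (intro equivariant_add equivariant_diff equivariant_T equivariant_scale
           equivariant_comp[OF equivariant_T equivariant_T]
           equivariant_comp[OF equivariant_scale equivariant_T])
    then show ?thesis using that(2) 2(1) by blast
  qed
qed

lemma scalars_imp_span_one:
  assumes "\<And>i. \<exists>t. \<forall>a\<in>A. T i a - t *\<^sub>R a \<in> M"
  shows "\<exists>v\<in>A. A = span (insert v M)"
proof -
  obtain v where v: "v \<in> A" "v \<notin> M" using M_subset M_neq by blast
  let ?I = "span (insert v M)"
  have inv: "T i a \<in> ?I" if "a \<in> ?I" for i a
  proof (rule linear_image_span_subset[OF linear_T _ subspace_span that])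
    fix x assume "x \<in> insert v M"
    then consider "x = v" | "x \<in> M" by blast
    then show "T i x \<in> ?I"
    proof cases
      case 1
      obtain t where "T i v - t *\<^sub>R v \<in> M" using assms v by blast
      then have "(T i v - t *\<^sub>R v) + t *\<^sub>R v \<in> ?I"
        by (intro span_add span_scale) (auto intro: span_base)
      then show ?thesis using 1 by simp
    qed (use T_M in \<open>auto intro: span_base\<close>)
  qed
  have "?I = M \<or> ?I = A"
    by (rule irreducible[OF subspace_span])
      (use inv v M_subset span_minimal[OF _ subspace_A, of "insert v M"] in \<open>auto intro: span_base\<close>)
  then show ?thesis using v by (metis span_base insertI1)
qed

text \<open>Modulo \<open>M\<close>, the operators \<open>X\<close> and \<open>Y\<close> commute and
  have squares \<open>- q^2\<close> and \<open>- d^2\<close>, so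
  \<open>(d X - q Y) (d X + q Y) = d^2 X^2 - q^2 Y^2\<close> vanishes. By \<open>schur\<close> one
  factor vanishes, and \<open>Y\<close> is a multiple of \<open>X\<close>.\<close>

lemma T_in_span_one_T:
  assumes i: "q \<noteq> 0" "\<And>a. a \<in> A \<Longrightarrow> T i (T i a) - (2 * p) *\<^sub>R T i a + (p\<^sup>2 + q\<^sup>2) *\<^sub>R a \<in> M"
  shows "\<exists>s t. \<forall>a\<in>A. T j a - (s *\<^sub>R a + t *\<^sub>R T i a) \<in> M"
proof (cases rule: scalar_or_quadratic[of j])
  case (1 s)
  then show ?thesis by (intro exI[of _ s] exI[of _ 0]) simp
next
  case j: (2 c d)
  define X where "X a = T i a - p *\<^sub>R a" for a
  define Y where "Y a = T j a - c *\<^sub>R a" for a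
  define P where "P a = d *\<^sub>R X a - q *\<^sub>R Y a" for a
  define Q where "Q a = d *\<^sub>R X a + q *\<^sub>R Y a" for a
  have eX: "equivariant X" and eY: "equivariant Y"
    unfolding X_def Y_def by (intro equivariant_diff equivariant_T equivariant_scale)+
  have eP: "equivariant P" and eQ: "equivariant Q"
    unfolding P_def Q_def
    using equivariant_comp[OF equivariant_scale eX, of d] equivariant_comp[OF equivariant_scale eY, of q]
    by (auto intro: equivariant_add equivariant_diff)
  note lin = linear_add[OF linear_T] linear_diff[OF linear_T] linear_scale[OF linear_T]
  have two: "(2 * r) *\<^sub>R x = r *\<^sub>R x + r *\<^sub>R x" for r and x :: 'a
    by (metis mult_2 scaleR_left_distrib)
  have PQ: "P (Q a) \<in> M" if a: "a \<in> A" for a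
  proof -
    let ?u = "T i (T i a) - (2 * p) *\<^sub>R T i a + (p\<^sup>2 + q\<^sup>2) *\<^sub>R a"
    let ?w = "T j (T j a) - (2 * c) *\<^sub>R T j a + (c\<^sup>2 + d\<^sup>2) *\<^sub>R a"
    let ?k = "T i (T j a) - T j (T i a)"
    have "d\<^sup>2 *\<^sub>R ?u - q\<^sup>2 *\<^sub>R ?w + (d * q) *\<^sub>R ?k \<in> M"
      by (intro subspace_add subspace_diff subspace_scale subspace_M i j T_commute a)
    also have "d\<^sup>2 *\<^sub>R ?u - q\<^sup>2 *\<^sub>R ?w + (d * q) *\<^sub>R ?k = P (Q a)"
      unfolding P_def Q_def X_def Y_def two
      by (simp add: lin algebra_simps power2_eq_square)
    finally show ?thesis .
  qed
  have "(\<forall>a\<in>A. P a \<in> M) \<or> (\<forall>a\<in>A. Q a \<in> M)"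
    using schur[OF eP _ _ PQ] eQ by (auto simp: equivariant_def)
  \<comment> \<open>The sign \<open>e\<close> is 1 if \<open>P\<close> vanishes modulo
    \<open>M\<close>, and -1 if \<open>Q\<close> does.\<close>
  then obtain e where e: "\<And>a. a \<in> A \<Longrightarrow> q *\<^sub>R Y a - (e * d) *\<^sub>R X a \<in> M"
  proof
    assume "\<forall>a\<in>A. P a \<in> M"
    then have "- P a \<in> M" if "a \<in> A" for a using that subspace_neg[OF subspace_M] by blast
    then show ?thesis using that[of 1] by (simp add: P_def)
  next
    assume "\<forall>a\<in>A. Q a \<in> M"
    then show ?thesis using that[of "-1"] by (simp add: Q_def add.commute)
  qed
  have "T j a - ((c - e * d / q * p) *\<^sub>R a + (e * d / q) *\<^sub>R T i a) \<in> M" if "a \<in> A" for a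
  proof -
    have "(1 / q) *\<^sub>R (q *\<^sub>R Y a - (e * d) *\<^sub>R X a) \<in> M"
      using e[OF that] by (rule subspace_scale[OF subspace_M])
    also have "(1 / q) *\<^sub>R (q *\<^sub>R Y a - (e * d) *\<^sub>R X a) =
        T j a - ((c - e * d / q * p) *\<^sub>R a + (e * d / q) *\<^sub>R T i a)"
      unfolding X_def Y_def using i(1) by (simp add: algebra_simps)
    finally show ?thesis .
  qed
  then show ?thesis by blast
qed

text \<open>If some \<open>T i\<close> is not a scalar, every operator is modulo \<open>M\<close> a
  combination of the identity and \<open>T i\<close>, and \<open>T i\<close> satisfies a quadratic
  equation; hence \<open>v\<close> and \<open>T i v\<close> span a submodule.\<close>

lemma span_two:
  obtains v w where "v \<in> A" "w \<in> A" "A = span (insert v (insert w M))"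
proof (cases "\<forall>i. \<exists>t. \<forall>a\<in>A. T i a - t *\<^sub>R a \<in> M")
  case True
  then obtain v where "v \<in> A" "A = span (insert v M)" using scalars_imp_span_one by blast
  then show ?thesis using that[of v v] by simp
next
  case False
  then obtain i where "\<nexists>t. \<forall>a\<in>A. T i a - t *\<^sub>R a \<in> M" by blast
  then obtain p q where q: "q \<noteq> 0"
    "\<And>a. a \<in> A \<Longrightarrow> T i (T i a) - (2 * p) *\<^sub>R T i a + (p\<^sup>2 + q\<^sup>2) *\<^sub>R a \<in> M"
    using scalar_or_quadratic[of i] by metis
  obtain v where v: "v \<in> A" "v \<notin> M" using M_subset M_neq by blast
  let ?I = "span (insert v (insert (T i v) M))"
  have M_I: "x \<in> M \<Longrightarrow> x \<in> ?I" for x by (simp add: span_base)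
  have gens: "v \<in> ?I" "T i v \<in> ?I" by (simp_all add: span_base)
  have inv: "T j a \<in> ?I" if "a \<in> ?I" for j a
  proof (rule linear_image_span_subset[OF linear_T _ subspace_span that])
    obtain s t where st: "\<forall>a\<in>A. T j a - (s *\<^sub>R a + t *\<^sub>R T i a) \<in> M"
      using T_in_span_one_T[OF q] by blast
    fix x assume "x \<in> insert v (insert (T i v) M)"
    then consider "x = v" | "x = T i v" | "x \<in> M" by blast
    then show "T j x \<in> ?I"
    proof cases
      case 1
      have "T j v - (s *\<^sub>R v + t *\<^sub>R T i v) + (s *\<^sub>R v + t *\<^sub>R T i v) \<in> ?I"
        by (intro span_add span_scale M_I gens) (use st v in blast)
      then show ?thesis using 1 by simp
    next
      case 2
      have "T i (T i v) - (2 * p) *\<^sub>R T i v + (p\<^sup>2 + q\<^sup>2) *\<^sub>R v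
          + (2 * p) *\<^sub>R T i v - (p\<^sup>2 + q\<^sup>2) *\<^sub>R v \<in> ?I"
        by (intro span_add span_diff span_scale gens M_I[OF q(2)[OF v(1)]])
      then have "T i (T i v) \<in> ?I" by simp
      moreover have "T j (T i v) - (s *\<^sub>R T i v + t *\<^sub>R T i (T i v)) \<in> ?I"
        by (intro M_I) (use st v T_A in blast)
      ultimately have "T j (T i v) - (s *\<^sub>R T i v + t *\<^sub>R T i (T i v)) + (s *\<^sub>R T i v + t *\<^sub>R T i (T i v)) \<in> ?I"
        by (intro span_add span_scale gens)
      then show ?thesis using 2 by simp
    qed (use T_M in \<open>auto intro: span_base\<close>)
  qed
  have "?I = M \<or> ?I = A"
    by (rule irreducible[OF subspace_span])
      (use inv v T_A M_subset span_minimal[OF _ subspace_A, of "insert v (insert (T i v) M)"] in \<open>auto intro: span_base\<close>)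
  then show ?thesis using that v gens T_A by metis
qed

end

section \<open>Lie algebras and their derived ideals\<close>

lemma exhaust_6: "x = 0 \<or> x = 1 \<or> x = 2 \<or> x = 3 \<or> x = 4 \<or> x = 5" for x :: 6
proof (induct x)
  case (of_int z)
  then have "0 \<le> z" "z < 6" by simp_all
  then have "z = 0 \<or> z = 1 \<or> z = 2 \<or> z = 3 \<or> z = 4 \<or> z = 5" by arith
  then show ?case by auto
qed

locale lie =
  fixes br :: "'a::euclidean_space \<Rightarrow> 'a \<Rightarrow> 'a"
  assumes lie: "lie_algebra br"
begin

definition "G1 = derived br 1"
definition "G2 = derived br 2"

definition ideal :: "'a set \<Rightarrow> bool" where
  "ideal I \<longleftrightarrow> subspace I \<and> (\<forall>x. \<forall>a\<in>I. br x a \<in> I)"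

lemma bilinear_br: "bilinear br"
  using lie by (simp add: lie_algebra_def)

lemma linear_right: "linear (br x)" and linear_left: "linear (\<lambda>x. br x y)"
  using bilinear_br by (simp_all add: bilinear_def)

lemmas br_simps = bilinear_ladd[OF bilinear_br] bilinear_radd[OF bilinear_br]
  bilinear_lsub[OF bilinear_br] bilinear_rsub[OF bilinear_br]
  bilinear_lmul[OF bilinear_br] bilinear_rmul[OF bilinear_br]
  bilinear_lneg[OF bilinear_br] bilinear_rneg[OF bilinear_br]
  bilinear_lzero[OF bilinear_br] bilinear_rzero[OF bilinear_br]

lemma br_self: "br x x = 0"
  using lie by (simp add: lie_algebra_def)

lemma br_skew: "br x y = - br y x"
proof -
  have "br x y + br y x = 0"
    using br_self[of "x + y"] unfolding br_simps by (simp add: br_self add.commute)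
  then show ?thesis by (simp only: eq_neg_iff_add_eq_0)
qed

lemma jacobi: "br x (br y z) = br (br x y) z + br y (br x z)"
proof -
  have "br x (br y z) + br y (br z x) + br z (br x y) = 0"
    using lie by (simp add: lie_algebra_def)
  moreover have "br y (br z x) = - br y (br x z)" by (subst (2) br_skew) (simp add: br_simps)
  moreover have "br z (br x y) = - br (br x y) z" by (rule br_skew)
  ultimately show ?thesis by (simp add: algebra_simps)
qed

lemma G1_eq: "G1 = span {br x y | x y. True}"
  by (simp add: G1_def)

lemma G2_eq: "G2 = span {br x y | x y. x \<in> G1 \<and> y \<in> G1}"
  by (simp add: G1_def G2_def numeral_2_eq_2)

lemma subspace_G1: "subspace G1" and subspace_G2: "subspace G2"
  by (simp_all add: G1_eq G2_eq)

lemma br_G1 [intro]: "br x y \<in> G1"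
  by (auto simp: G1_eq intro: span_base)

lemma br_G2: "x \<in> G1 \<Longrightarrow> y \<in> G1 \<Longrightarrow> br x y \<in> G2"
  by (auto simp: G2_eq intro!: span_base)

lemma G1_minimal: "subspace S \<Longrightarrow> (\<And>x y. br x y \<in> S) \<Longrightarrow> G1 \<subseteq> S"
  unfolding G1_eq by (rule span_minimal) auto

lemma G2_minimal: "subspace S \<Longrightarrow> (\<And>x y. x \<in> G1 \<Longrightarrow> y \<in> G1 \<Longrightarrow> br x y \<in> S) \<Longrightarrow> G2 \<subseteq> S"
  unfolding G2_eq by (rule span_minimal) auto

lemma G2_subset_G1: "G2 \<subseteq> G1"
  by (rule G2_minimal[OF subspace_G1 br_G1])

lemma ideal_G2: "ideal G2"
proof -
  have "G2 \<subseteq> {z. \<forall>x. br x z \<in> G2}"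
  proof (rule G2_minimal)
    show "subspace {z. \<forall>x. br x z \<in> G2}"
      using subspace_G2 by (auto simp: subspace_def br_simps)
    show "br y z \<in> {z. \<forall>x. br x z \<in> G2}" if "y \<in> G1" "z \<in> G1" for y z
      using that by (auto simp: jacobi[of _ y z] intro!: subspace_add[OF subspace_G2] br_G2)
  qed
  then show ?thesis by (auto simp: ideal_def subspace_G2)
qed

text \<open>In this form the Jacobi identity shows that adjoint operators commute on
  \<open>G1\<close> modulo \<open>G2\<close>, since \<open>br x y\<close> lies in
  \<open>G1\<close>.\<close>

lemma br_commutator: "br x (br y a) - br y (br x a) = br (br x y) a"
  using jacobi[of x y a] by simp

lemma ideal_right: "ideal I \<Longrightarrow> a \<in> I \<Longrightarrow> br x a \<in> I"
  by (simp add: ideal_def)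

lemma G1_decompose:
  assumes "G1 = span (insert v (insert w G2))" "x \<in> G1"
  obtains k l m where "m \<in> G2" "x = k *\<^sub>R v + l *\<^sub>R w + m"
proof -
  obtain k l where "x - k *\<^sub>R v - l *\<^sub>R w \<in> G2"
    using assms(2) span_eq_iff[THEN iffD2, OF subspace_G2] unfolding assms(1)
    by (auto simp: span_breakdown_eq)
  then show ?thesis
    by (intro that[of "x - k *\<^sub>R v - l *\<^sub>R w" k l]) simp_all
qed

text \<open>Since \<open>G2\<close> is central in \<open>G1\<close>, a bracket in \<open>G1\<close>
  is the determinant of the coordinates along \<open>v\<close> and \<open>w\<close>, times
  \<open>br v w\<close>.\<close>

lemma G2_subset_span_bracket:
  assumes G1: "G1 = span (insert v (insert w G2))"
    and central: "\<And>a z. a \<in> G1 \<Longrightarrow> z \<in> G2 \<Longrightarrow> br a z = 0"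
  shows "G2 \<subseteq> span {br v w}"
proof (rule G2_minimal)
  have vw: "v \<in> G1" "w \<in> G1" unfolding G1 by (auto intro: span_base)
  fix x y assume "x \<in> G1" "y \<in> G1"
  then obtain k l m k' l' m' where m: "m \<in> G2" "m' \<in> G2"
    and x: "x = k *\<^sub>R v + l *\<^sub>R w + m" and y: "y = k' *\<^sub>R v + l' *\<^sub>R w + m'" using G1_decompose[OF G1] by metis
  have "m \<in> G1" using m G2_subset_G1 by blast
  then have 0: "br v m' = 0" "br w m' = 0" "br m m' = 0" "br m v = 0" "br m w = 0"
    using central m vw by (auto simp: br_skew[of m v] br_skew[of m w])
  have "br x y = (k * l' - l * k') *\<^sub>R br v w"
    unfolding x y using 0 by (simp add: br_simps br_self br_skew[of w v] algebra_simps)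
  then show "br x y \<in> span {br v w}" by (simp add: span_base span_scale)
qed simp

lemma ideal_sums:
  assumes "ideal I" "ideal J"
  shows "ideal {x + y | x y. x \<in> I \<and> y \<in> J}"
  unfolding ideal_def
proof (intro conjI allI ballI)
  show "subspace {x + y | x y. x \<in> I \<and> y \<in> J}"
    using assms by (intro subspace_sums) (auto simp: ideal_def)
  show "br g a \<in> {x + y | x y. x \<in> I \<and> y \<in> J}" if a: "a \<in> {x + y | x y. x \<in> I \<and> y \<in> J}" for g a
  proof -
    obtain x y where "x \<in> I" "y \<in> J" "a = x + y" using a by blast
    then have "br g a = br g x + br g y" "br g x \<in> I" "br g y \<in> J"
      using assms by (simp_all add: br_simps ideal_right)
    then show ?thesis by blast
  qed
qed

definition "centralizer = {c. \<forall>a\<in>G1. br c a = 0}"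

lemma subspace_centralizer: "subspace centralizer"
  by (auto simp: subspace_def centralizer_def br_simps)

lemma ideal_centralizer: "ideal centralizer"
  unfolding ideal_def
proof (intro conjI allI ballI subspace_centralizer)
  fix g c assume c: "c \<in> centralizer"
  have "br (br g c) a = 0" if "a \<in> G1" for a
    using c that by (auto simp: centralizer_def br_G1 br_simps simp flip: br_commutator)
  then show "br g c \<in> centralizer" by (simp add: centralizer_def)
qed

section \<open>Recognition of the model by its bracket table\<close>

lemma lie_isomorphic_to_R_s545I:
  assumes brackets: "br x1 x2 = 0" "br x1 y1 = y1" "br x1 y2 = y2" "br x1 z = 2 *\<^sub>R z"
      "br x2 y1 = y2" "br x2 y2 = - y1" "br x2 z = 0"
      "br y1 y2 = z" "br y1 z = 0" "br y2 z = 0"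
      "br c x1 = 0" "br c x2 = 0" "br c y1 = 0" "br c y2 = 0" "br c z = 0"
    and nonzero: "z \<noteq> 0" "c \<notin> span {z}" and dim: "DIM('a) = 6"
  shows "lie_isomorphic_to_R_s545 br"
proof -
  define g :: "real^6 \<Rightarrow> 'a" where
    "g u = u$0 *\<^sub>R c + u$1 *\<^sub>R x1 + u$2 *\<^sub>R x2 + u$3 *\<^sub>R y1 + u$4 *\<^sub>R y2 + u$5 *\<^sub>R z" for u
  have lin: "linear g"
    by (rule linearI) (simp_all add: g_def algebra_simps)
  note table = brackets br_self
    br_skew[of x2 x1] br_skew[of y1 x1] br_skew[of y2 x1] br_skew[of z x1]
    br_skew[of y1 x2] br_skew[of y2 x2] br_skew[of z x2] br_skew[of y2 y1] br_skew[of z y1] br_skew[of z y2]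
    br_skew[of x1 c] br_skew[of x2 c] br_skew[of y1 c] br_skew[of y2 c] br_skew[of z c]
  have hom: "br (g u) (g v) = g (R_s545_br u v)" for u v
    unfolding g_def by (simp add: br_simps table R_s545_br_def algebra_simps)
  have "u = 0" if u: "g u = 0" for u
  proof -
    \<comment> \<open>The double brackets isolate coordinates 1 and 2, and the single ones then give
      3 and 4. Independence of \<open>c\<close> and \<open>z\<close> settles 0 and 5.\<close>
    have 1: "br (br (g u) y1) y2 = (u$1) *\<^sub>R z" "br (br (g u) y1) y1 = - (u$2) *\<^sub>R z"
      "br (g u) y1 = u$1 *\<^sub>R y1 + u$2 *\<^sub>R y2 - u$4 *\<^sub>R z"
      "br (g u) y2 = u$1 *\<^sub>R y2 - u$2 *\<^sub>R y1 + u$3 *\<^sub>R z"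
      unfolding g_def by (simp_all add: br_simps table)
    then have u12: "u$1 = 0" "u$2 = 0" using u nonzero by (auto simp: br_simps)
    then have u34: "u$3 = 0" "u$4 = 0" using 1 u nonzero by (auto simp: br_simps)
    then have uz: "u$0 *\<^sub>R c + u$5 *\<^sub>R z = 0" using u u12 by (simp add: g_def)
    have u0: "u$0 = 0"
    proof (rule ccontr)
      assume "u$0 \<noteq> 0"
      moreover have "u$0 *\<^sub>R c = (- u$5) *\<^sub>R z" using uz by (simp add: eq_neg_iff_add_eq_0)
      ultimately have "c = (- u$5 / u$0) *\<^sub>R z"
        by (metis (no_types, opaque_lifting) divide_inverse_commute scaleR_one scaleR_scaleR left_inverse)
      then have "c \<in> span {z}" by (metis span_base span_scale singletonI)
      then show False using nonzero(2) by simp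
    qed
    then have "u$5 = 0" using uz nonzero by simp
    then have "u$i = 0" for i using exhaust_6[of i] u0 u12 u34 by auto
    then show ?thesis by (simp add: vec_eq_iff)
  qed
  then have inj: "inj g" using linear_injective_0[OF lin] by blast
  have "dim (range g) = DIM('a)"
    using dim_image_eq[OF lin, of UNIV] inj dim by simp
  then have "span (range g) = UNIV" by (simp add: dim_eq_full)
  then have surj: "surj g" using linear_subspace_image[OF lin subspace_UNIV] by (metis span_eq_iff)
  obtain h where h: "linear h" "h \<circ> g = id" using linear_injective_left_inverse[OF lin inj] by blast
  then have hg: "h (g u) = u" for u by (metis comp_apply id_apply)
  have "bij h"
    unfolding bij_def
  proof
    show "inj h" by (rule injI) (metis hg surj surjD)
    show "surj h" by (metis hg surjI)
  qed
  moreover have "h (br x y) = R_s545_br (h x) (h y)" for x y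
    by (metis hg hom surj surjD)
  ultimately show ?thesis unfolding lie_isomorphic_to_R_s545_def using h by blast
qed

end

section \<open>The bound derived from the coadjoint orbits\<close>

text \<open>The hypothesis on coadjoint orbits enters only through the following bound: for a functional
  vanishing on a proper subspace of the derived algebra, every vector whose brackets all lie in
  that subspace is in the kernel of the associated alternating form, and this kernel is a plane.\<close>

lemma MD_algebra_dim_le_2:
  fixes br :: "'a::euclidean_space \<Rightarrow> 'a \<Rightarrow> 'a"
  assumes MD: "MD_algebra (DIM('a) - 2) br" and dim: "DIM('a) \<ge> 2"
    and I: "subspace I" "I \<subseteq> derived br 1" "I \<noteq> derived br 1"
    and S: "\<And>s y. s \<in> S \<Longrightarrow> br y s \<in> I"
  shows "dim S \<le> 2"
proof -
  interpret lie br using MD by unfold_locales (simp add: MD_algebra_def)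
  have sub: "subspace (derived br 1)" by simp
  have "span I \<subset> span (derived br 1)"
    using I sub by (simp add: span_eq_iff[THEN iffD2] psubset_eq)
  then obtain f where f: "f \<noteq> 0" "f \<in> span (derived br 1)" "\<And>y. y \<in> span I \<Longrightarrow> orthogonal f y"
    using orthogonal_to_subspace_exists_gen by metis
  have fG: "f \<in> derived br 1" using f(2) sub by (simp add: span_eq_iff[THEN iffD2])
  \<comment> \<open>Pairing with \<open>f\<close> vanishes on \<open>I\<close> but not at
    \<open>f\<close>, an element of the derived algebra. The orbit is thus non-trivial, and the form
    has rank \<open>DIM('a) - 2\<close>.\<close>
  let ?F = "\<lambda>x. f \<bullet> x"
  let ?L = "\<lambda>x. \<Sum>b\<in>Basis. ?F (br x b) *\<^sub>R b"
  have "linear ?F" by (simp add: bounded_linear.linear bounded_linear_inner_right)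
  moreover have "?F f \<noteq> 0" using f by simp
  ultimately have "coadj_orbit_dim br ?F = DIM('a) - 2"
    using MD fG unfolding MD_algebra_def by blast
  then have range: "dim (range ?L) = DIM('a) - 2" by (simp add: coadj_orbit_dim_def)
  have "linear ?L"
    by (rule linearI) (simp_all add: br_simps inner_right_distrib scaleR_left_distrib sum.distrib scaleR_sum_right)
  then have "dim {x \<in> UNIV. ?L x = 0} + dim (range ?L) = dim (UNIV :: 'a set)"
    by (rule dim_kernel_image[OF _ subspace_UNIV])
  then have "dim {x \<in> UNIV. ?L x = 0} = 2" using range dim by simp
  moreover have "dim S \<le> dim {x \<in> UNIV. ?L x = 0}"
  proof (rule dim_subset, rule subsetI)
    fix s assume "s \<in> S"
    have "?F (br s b) = 0" for b
      using f(3)[OF span_base[OF S[OF \<open>s \<in> S\<close>]]] by (simp add: br_skew[of s b] orthogonal_def)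
    then show "s \<in> {x \<in> UNIV. ?L x = 0}" by simp
  qed
  ultimately show ?thesis by linarith
qed

section \<open>Dimensions of the derived algebras\<close>

locale md_lie = lie +
  assumes dim_le_2: "subspace I \<Longrightarrow> I \<subseteq> G1 \<Longrightarrow> I \<noteq> G1 \<Longrightarrow> subspace S \<Longrightarrow>
      (\<And>s y. s \<in> S \<Longrightarrow> br y s \<in> I) \<Longrightarrow> dim S \<le> 2"
    and G2_abelian: "x \<in> G2 \<Longrightarrow> y \<in> G2 \<Longrightarrow> br x y = 0"
    and G2_nonzero: "G2 \<noteq> {0}"
begin

lemma G2_neq_G1: "G2 \<noteq> G1"
proof
  assume eq: "G2 = G1"
  have "G2 \<subseteq> {0}"
    by (rule G2_minimal) (use G2_abelian eq in auto)
  then show False using G2_nonzero subspace_0[OF subspace_G2] by blast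
qed

text \<open>An ideal can serve as both \<open>I\<close> and \<open>S\<close> in
  \<open>dim_le_2\<close>.\<close>

lemma dim_ideal_le_2: "ideal I \<Longrightarrow> I \<subseteq> G1 \<Longrightarrow> I \<noteq> G1 \<Longrightarrow> dim I \<le> 2"
  by (rule dim_le_2[of I]) (auto simp: ideal_def)

text \<open>Maximal dimension makes the quotient of \<open>G1\<close> by \<open>M\<close>
  irreducible; containing \<open>G2\<close> makes the adjoint operators commute on it.\<close>

lemma obtain_maximal_ideal:
  obtains M where "ideal M" "G2 \<subseteq> M" "M \<subseteq> G1" "M \<noteq> G1" "irreducible_commuting br G1 M"
proof -
  let ?P = "\<lambda>M. ideal M \<and> G2 \<subseteq> M \<and> M \<subseteq> G1 \<and> M \<noteq> G1"
  have "?P G2" using ideal_G2 G2_subset_G1 G2_neq_G1 by blast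
  moreover have "\<forall>M. ?P M \<longrightarrow> dim M < Suc (DIM('a))"
    using dim_subset_UNIV by (auto simp: less_Suc_eq_le)
  ultimately obtain M where M: "?P M" and max: "\<And>N. ?P N \<Longrightarrow> dim N \<le> dim M"
    using ex_has_greatest_nat[of ?P G2 dim "Suc (DIM('a))"] by (metis (no_types, lifting))
  have "irreducible_commuting br G1 M"
  proof (rule irreducible_commuting.intro)
    show "br i a \<in> M" if "a \<in> M" for i a using M that by (auto simp: ideal_def)
    show "br i (br j a) - br j (br i a) \<in> M" if "a \<in> G1" for i j a
      using M that br_G2 by (auto simp: br_commutator)
    show "I = M \<or> I = G1" if "subspace I" "M \<subseteq> I" "I \<subseteq> G1" "\<And>i a. a \<in> I \<Longrightarrow> br i a \<in> I" for I
    proof (cases "I = G1")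
      case False
      then have "dim I \<le> dim M" using M that by (intro max) (unfold ideal_def, blast)
      then show ?thesis using subspace_dim_equal[of M I] M that by (auto simp: ideal_def)
    qed simp
  qed (use M in \<open>auto simp: linear_right subspace_G1 ideal_def br_G1\<close>)
  then show ?thesis using that M by blast
qed

text \<open>If \<open>dim G2 = 2\<close> and \<open>G1\<close> acts nontrivially on \<open>G2\<close>, it acts by commuting traceless
  \<open>2 \<times> 2\<close> matrices, which are proportional to a single \<open>N\<close>; the bound forces \<open>[X, N] = s N\<close> for some
  \<open>X\<close> and \<open>s \<noteq> 0\<close>, hence \<open>det N = 0\<close>, contradicting \<open>[G1, G1] = N G2\<close>.\<close>

lemma dim_G2: "dim G2 = 1"
proof (rule ccontr)
  assume not1: "dim G2 \<noteq> 1"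
  obtain M where M: "ideal M" "G2 \<subseteq> M" "M \<subseteq> G1" "M \<noteq> G1" "irreducible_commuting br G1 M"
    by (rule obtain_maximal_ideal)
  have "dim M \<le> 2" using M dim_ideal_le_2 by blast
  moreover have "dim G2 \<le> dim M" using M dim_subset by blast
  moreover have "dim G2 \<noteq> 0" using G2_nonzero subspace_0[OF subspace_G2] by (auto simp: dim_eq_0)
  \<comment> \<open>The bound leaves only dimension 2 for \<open>G2\<close>, so
    \<open>M = G2\<close> and \<open>G1/G2\<close> is irreducible.\<close>
  ultimately have two: "dim G2 = 2" "dim M \<le> dim G2" using not1 by linarith+
  then have "M = G2" using subspace_dim_equal[of G2 M] M subspace_G2 by (auto simp: ideal_def)
  then interpret irreducible_commuting br G1 G2 using M by simp
  obtain B where B: "B \<subseteq> G2" "independent B" "G2 \<subseteq> span B" "card B = 2"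
    using basis_exists[of G2] two by metis
  then obtain z1 z2 where z: "B = {z1, z2}" "z1 \<noteq> z2" by (metis card_2_iff)
  obtain f1 where f1: "linear f1" "f1 z1 = (1::real)" "f1 z2 = 0"
    using linear_independent_extend[OF B(2), of "\<lambda>x. if x = z1 then 1 else 0"] z by auto
  obtain f2 where f2: "linear f2" "f2 z1 = (0::real)" "f2 z2 = 1"
    using linear_independent_extend[OF B(2), of "\<lambda>x. if x = z2 then 1 else 0"] z by auto
  note lin = linear_add[OF f1(1)] linear_add[OF f2(1)] linear_diff[OF f1(1)] linear_diff[OF f2(1)]
    linear_scale[OF f1(1)] linear_scale[OF f2(1)] linear_0[OF f1(1)] linear_0[OF f2(1)]
  have coord: "x = f1 x *\<^sub>R z1 + f2 x *\<^sub>R z2" if "x \<in> G2" for x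
  proof -
    have "x \<in> span {z1, z2}" using that B(3) z by blast
    then obtain k l where "x - k *\<^sub>R z1 - l *\<^sub>R z2 = 0"
      by (simp only: span_breakdown_eq span_empty singleton_iff) blast
    then have "x = k *\<^sub>R z1 + l *\<^sub>R z2" by (simp add: algebra_simps)
    then show ?thesis by (simp add: lin f1 f2)
  qed
  have zG: "z1 \<in> G2" "z2 \<in> G2" using B z by auto
  \<comment> \<open>Entries of the matrix of \<open>br g\<close> on \<open>G2\<close> in the basis
    \<open>z1\<close>, \<open>z2\<close>: first row \<open>a\<close>, \<open>b\<close>, second row
    \<open>c\<close>, \<open>d\<close>.\<close>
  define a where "a g = f1 (br g z1)" for g
  define b where "b g = f1 (br g z2)" for g
  define c where "c g = f2 (br g z1)" for g
  define d where "d g = f2 (br g z2)" for g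
  have act1: "br g z1 = a g *\<^sub>R z1 + c g *\<^sub>R z2" and act2: "br g z2 = b g *\<^sub>R z1 + d g *\<^sub>R z2" for g
    unfolding a_def b_def c_def d_def by (intro coord ideal_right[OF ideal_G2] zG)+
  have com: "br (br g h) z = br g (br h z) - br h (br g z)" for g h z
    by (simp add: br_commutator)
  have com_a: "a (br g h) = b g * c h - b h * c g"
    and com_b: "b (br g h) = a g * b h + b g * d h - a h * b g - b h * d g"
    and com_c: "c (br g h) = c g * a h + d g * c h - c h * a g - d h * c g"
    and com_d: "d (br g h) = c g * b h - c h * b g" for g h
    unfolding a_def[of "br g h"] b_def[of "br g h"] c_def[of "br g h"] d_def[of "br g h"] com
    by (simp_all add: act1 act2 br_simps lin f1 f2 algebra_simps)
  have lins: "a (x + y) = a x + a y" "b (x + y) = b x + b y" "c (x + y) = c x + c y" "d (x + y) = d x + d y"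
    "a (k *\<^sub>R x) = k * a x" "b (k *\<^sub>R x) = k * b x" "c (k *\<^sub>R x) = k * c x" "d (k *\<^sub>R x) = k * d x"
    "a 0 = 0" "b 0 = 0" "c 0 = 0" "d 0 = 0" for x y k
    by (simp_all add: a_def b_def c_def d_def br_simps lin)
  have "G1 \<subseteq> {g. a g + d g = 0}"
  proof (rule G1_minimal)
    have "a (k *\<^sub>R x) + d (k *\<^sub>R x) = k * (a x + d x)" for k x by (simp add: lins distrib_left)
    then show "subspace {g. a g + d g = 0}" by (auto simp: subspace_def lins)
  qed (simp add: com_a com_d)
  then have trace: "d g = - a g" if "g \<in> G1" for g using that by auto
  \<comment> \<open>\<open>br g h\<close> lies in the abelian \<open>G2\<close>, so the matrices of
    \<open>g\<close> and \<open>h\<close> commute. For traceless 2 by 2 matrices this means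
    proportionality.\<close>
  have proportional: "c h * b g = c g * b h" "b h * a g = b g * a h" "a h * c g = a g * c h"
    if "g \<in> G1" "h \<in> G1" for g h
  proof -
    have "br (br g h) x = 0" if "x \<in> G2" for x
      using G2_abelian br_G2 \<open>g \<in> G1\<close> \<open>h \<in> G1\<close> that by blast
    then have "a (br g h) = 0" "b (br g h) = 0" "c (br g h) = 0"
      unfolding a_def b_def c_def using zG by (simp_all add: lin)
    then show "c h * b g = c g * b h" "b h * a g = b g * a h" "a h * c g = a g * c h"
      unfolding com_a com_b com_c using trace that by (simp_all add: algebra_simps)
  qed
  have kills: "br x y = 0" if "a x = 0" "b x = 0" "c x = 0" "d x = 0" "y \<in> G2" for x y
    by (subst coord[OF \<open>y \<in> G2\<close>]) (simp add: br_simps act1 act2 that)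
  show False
  proof (cases "\<forall>x\<in>G1. a x = 0 \<and> b x = 0 \<and> c x = 0")
    case True
    then have 0: "br x y = 0" if "x \<in> G1" "y \<in> G2" for x y
      using kills trace that by auto
    obtain v w where "G1 = span (insert v (insert w G2))" by (rule span_two)
    then have "G2 \<subseteq> span {br v w}" using 0 by (rule G2_subset_span_bracket)
    then have "dim G2 \<le> 1" using dim_le_card[of G2 "{br v w}"] by simp
    then show False using two by simp
  next
    case False
    then obtain u where u: "u \<in> G1" "a u \<noteq> 0 \<or> b u \<noteq> 0 \<or> c u \<noteq> 0" by blast
    \<comment> \<open>The kernel of the action of \<open>G1\<close> on \<open>G2\<close>: an ideal
      containing \<open>G2\<close> and properly contained in \<open>G1\<close>, hence equal to
      \<open>G2\<close> by the bound.\<close>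
    let ?D = "{x \<in> G1. \<forall>y\<in>G2. br x y = 0}"
    have D: "ideal ?D"
      unfolding ideal_def
    proof (intro conjI allI ballI)
      show "subspace ?D" using subspace_G1 by (auto simp: subspace_def br_simps)
      show "br g x \<in> ?D" if "x \<in> ?D" for g x
        using that ideal_right[OF ideal_G2] by (auto simp: com br_simps)
    qed
    have "u \<notin> ?D"
    proof
      assume "u \<in> ?D"
      then have "br u z1 = 0" "br u z2 = 0" using zG by auto
      then show False using u(2) by (simp add: a_def b_def c_def lin)
    qed
    then have "?D \<noteq> G1" using u by blast
    then have "dim ?D \<le> dim G2" using dim_ideal_le_2[OF D] two by auto
    then have DG2: "?D = G2"
      using subspace_dim_equal[of G2 ?D] subspace_G2 D G2_subset_G1 G2_abelian by (auto simp: ideal_def)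
    \<comment> \<open>The matrix of \<open>h\<close> is \<open>s\<close> times that of
      \<open>u\<close>, so the difference acts trivially: modulo \<open>G2\<close>,
      \<open>G1\<close> is the line through \<open>u\<close>.\<close>
    have dec: "\<exists>s. h - s *\<^sub>R u \<in> G2" if h: "h \<in> G1" for h
    proof -
      obtain s where s: "a h = s * a u" "b h = s * b u" "c h = s * c u"
      proof -
        from u(2) consider "a u \<noteq> 0" | "b u \<noteq> 0" | "c u \<noteq> 0" by blast
        then show ?thesis
          by cases (use that[of "a h / a u"] that[of "b h / b u"] that[of "c h / c u"]
              proportional[OF u(1) h] in \<open>auto simp: field_simps\<close>)
      qed
      have hs: "h - s *\<^sub>R u \<in> G1" using subspace_diff subspace_scale subspace_G1 h u by blast
      have "a (h + (- s) *\<^sub>R u) = 0" "b (h + (- s) *\<^sub>R u) = 0" "c (h + (- s) *\<^sub>R u) = 0"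
        unfolding lins s by simp_all
      then have "h - s *\<^sub>R u \<in> ?D" using hs kills trace[OF hs] by auto
      then show ?thesis unfolding DG2 by blast
    qed
    \<comment> \<open>Otherwise all brackets with \<open>G1\<close> lie in \<open>G2\<close>, and
      the bound with \<open>S = G1\<close> gives \<open>dim G1 \<le> 2\<close>.\<close>
    have "\<exists>x. br x u \<notin> G2"
    proof (rule ccontr)
      assume "\<nexists>x. br x u \<notin> G2"
      then have xu: "br x u \<in> G2" for x by blast
      have "dim G1 \<le> 2"
      proof (rule dim_le_2[OF subspace_G2 G2_subset_G1 G2_neq_G1 subspace_G1])
        fix h y assume "h \<in> G1"
        then obtain s where s: "h - s *\<^sub>R u \<in> G2" using dec by blast
        have "br y (h - s *\<^sub>R u) + s *\<^sub>R br y u \<in> G2"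
          by (intro subspace_add subspace_scale subspace_G2 ideal_right[OF ideal_G2] s xu)
        then show "br y h \<in> G2" by (simp add: br_simps)
      qed
      then show False
        using subspace_dim_equal[OF subspace_G2 subspace_G1 G2_subset_G1] two G2_neq_G1 by simp
    qed
    then obtain x where x: "br x u \<notin> G2" by blast
    obtain s where s: "br x u - s *\<^sub>R u \<in> G2" using dec by blast
    have "s \<noteq> 0" using x s by auto
    have xu: "br (br x u) y = s *\<^sub>R br u y" if "y \<in> G2" for y
      using G2_abelian[OF s that] by (simp add: br_simps)
    have "a (br x u) = s * a u" "b (br x u) = s * b u" "c (br x u) = s * c u"
      unfolding a_def b_def c_def by (simp_all add: xu zG lin)
    then have eqs: "s * a u = b x * c u - b u * c x"
       "s * b u = (a x - d x) * b u - 2 * a u * b x" "s * c u = 2 * c x * a u + (d x - a x) * c u"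
      unfolding com_a com_b com_c trace[OF u(1)] by (simp_all add: algebra_simps)
    \<comment> \<open>With \<open>X\<close> and \<open>N\<close> the matrices of \<open>x\<close>
      and \<open>u\<close>, this is the trace of \<open>[X, N] N = s N^2\<close>, whose left side
      has trace zero.\<close>
    have "2 * s * ((a u)\<^sup>2 + b u * c u) = 0"
      using eqs by algebra
    then have det: "(a u)\<^sup>2 + b u * c u = 0" using \<open>s \<noteq> 0\<close> by simp
    \<comment> \<open>\<open>?K\<close> is cut out by the kernel equations of the matrix of
      \<open>u\<close>. Its trace and determinant vanish, so its square is zero and it maps
      \<open>G2\<close> into \<open>?K\<close>; every bracket in \<open>G1\<close> is such an
      image.\<close>
    have "G2 \<subseteq> {x. c u * f1 x - a u * f2 x = 0 \<and> a u * f1 x + b u * f2 x = 0}" (is "_ \<subseteq> ?K")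
    proof (rule G2_minimal)
      show K: "subspace ?K"
      proof (rule subspaceI)
        fix x y assume "x \<in> ?K" "y \<in> ?K"
        then show "x + y \<in> ?K" by (simp add: lin distrib_left)
      next
        fix k x assume "x \<in> ?K"
        then have "k * (c u * f1 x - a u * f2 x) = 0" "k * (a u * f1 x + b u * f2 x) = 0" by auto
        then show "k *\<^sub>R x \<in> ?K" by (simp add: lin algebra_simps)
      qed (simp add: lin)
      have uK: "br u y \<in> ?K" if "y \<in> G2" for y
      proof -
        have "br u z1 \<in> ?K" "br u z2 \<in> ?K"
          using det by (simp_all add: act1 act2 lin f1 f2 trace[OF u(1)] power2_eq_square algebra_simps)
        then have "f1 y *\<^sub>R br u z1 + f2 y *\<^sub>R br u z2 \<in> ?K"
          by (intro subspace_add[OF K] subspace_scale[OF K])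
        then show ?thesis by (subst coord[OF that]) (simp add: br_simps)
      qed
      fix g h assume "g \<in> G1" "h \<in> G1"
      then obtain s t where st: "g - s *\<^sub>R u \<in> G2" "h - t *\<^sub>R u \<in> G2" using dec by blast
      have "br (g - s *\<^sub>R u) (h - t *\<^sub>R u) = 0" using st G2_abelian by blast
      then have "br g h = s *\<^sub>R br u (h - t *\<^sub>R u) - t *\<^sub>R br u (g - s *\<^sub>R u)"
        by (simp add: br_simps br_self br_skew[of g u] algebra_simps)
      also have "\<dots> \<in> ?K" by (intro subspace_diff[OF K] subspace_scale[OF K] uK st)
      finally show "br g h \<in> ?K" .
    qed
    then have "z1 \<in> ?K" "z2 \<in> ?K" using zG by auto
    then show False using u(2) by (simp add: f1 f2)
  qed
qed

lemma G2_span: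
  obtains z where "z \<noteq> 0" "z \<in> G2" "G2 = span {z}"
proof -
  obtain z where z: "z \<in> G2" "z \<noteq> 0" using G2_nonzero subspace_0[OF subspace_G2] by blast
  have "G2 = span (insert z {0})"
    by (rule subspace_span_insert) (use z subspace_G2 dim_G2 subspace_0 in auto)
  also have "\<dots> = span {z}" by (simp add: insert_commute[of z 0] span_insert_0)
  finally show ?thesis using that z by blast
qed

text \<open>Every element acts on the line \<open>G2\<close> by a scalar; scalars commute, so
  brackets act by zero.\<close>

lemma G1_G2_commute:
  assumes "a \<in> G1" "z \<in> G2"
  shows "br a z = 0"
proof -
  obtain u where u: "u \<noteq> 0" "u \<in> G2" "G2 = span {u}" by (rule G2_span)
  have mult: "\<exists>k. x = k *\<^sub>R u" if "x \<in> G2" for x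
    using that unfolding u(3) by (auto simp: span_singleton)
  have "G1 \<subseteq> {g. br g u = 0}"
  proof (rule G1_minimal)
    show "subspace {g. br g u = 0}" by (auto simp: subspace_def br_simps)
    fix g h
    obtain k l where kl: "br g u = k *\<^sub>R u" "br h u = l *\<^sub>R u"
      using mult ideal_right[OF ideal_G2 u(2)] by metis
    have "br (br g h) u = br g (br h u) - br h (br g u)" by (simp add: br_commutator)
    also have "\<dots> = 0" by (simp add: kl br_simps)
    finally show "br g h \<in> {g. br g u = 0}" by simp
  qed
  moreover obtain k where "z = k *\<^sub>R u" using mult assms by blast
  ultimately show ?thesis using assms by (auto simp: br_simps)
qed

text \<open>Both \<open>M\<close> and \<open>G1/M\<close> have dimension at most 2. In dimension 2,
  \<open>G1\<close> would be abelian; in dimension 4, some \<open>x\<close> acts on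
  \<open>G1/M\<close> by no scalar, which leads to an impossible ideal.\<close>

lemma dim_G1: "dim G1 = 3"
proof -
  obtain M where M: "ideal M" "G2 \<subseteq> M" "M \<subseteq> G1" "M \<noteq> G1" "irreducible_commuting br G1 M"
    by (rule obtain_maximal_ideal)
  interpret irreducible_commuting br G1 M by (rule M)
  have M2: "dim M \<le> 2" using M dim_ideal_le_2 by blast
  obtain v w where "G1 = span (insert v (insert w M))" by (rule span_two)
  then have G1M: "dim G1 \<le> dim M + 2" by (simp add: dim_insert)
  have "\<not> dim G1 \<le> 2"
  proof
    assume le: "dim G1 \<le> 2"
    obtain u where u: "u \<in> G1" "u \<notin> G2" using G2_subset_G1 G2_neq_G1 by blast
    have "G1 = span (insert u G2)"
      by (rule subspace_span_insert[OF subspace_G2 subspace_G1 G2_subset_G1 u]) (use le dim_G2 in simp)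
    then have "G2 \<subseteq> span {br u u}" using G1_G2_commute by (intro G2_subset_span_bracket) auto
    then show False using G2_nonzero subspace_0[OF subspace_G2] by (auto simp: br_self)
  qed
  moreover have "dim G1 \<noteq> 4"
  proof
    assume four: "dim G1 = 4"
    then have M_eq: "dim M = 2" using G1M M2 by linarith
    have "\<exists>x. \<forall>t. \<exists>a\<in>G1. br x a - t *\<^sub>R a \<notin> M"
    proof (rule ccontr)
      assume "\<not> ?thesis"
      then obtain v where "G1 = span (insert v M)" using scalars_imp_span_one by blast
      then have "dim G1 \<le> dim M + 1" by (simp add: dim_insert)
      then show False using four M_eq by simp
    qed
    then obtain x where x: "\<And>t. \<exists>a\<in>G1. br x a - t *\<^sub>R a \<notin> M" by blast
    have "G2 \<noteq> M" using M_eq dim_G2 by auto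
    then obtain m where m: "m \<in> M" "m \<notin> G2" using M by blast
    have Mspan: "M = span (insert m G2)"
      by (rule subspace_span_insert[OF subspace_G2 subspace_M M(2) m]) (use M_eq dim_G2 in simp)
    have "br x m \<in> span (insert m G2)" using T_M[OF m(1)] Mspan by blast
    then obtain t where t: "br x m - t *\<^sub>R m \<in> G2"
      using span_eq_iff[THEN iffD2, OF subspace_G2] by (auto simp: span_breakdown_eq)
    \<comment> \<open>\<open>x\<close> acts on \<open>M\<close> modulo \<open>G2\<close> by the scalar \<open>t\<close>, but on \<open>G1\<close> modulo \<open>M\<close> by no scalar, so the
      image of \<open>L\<close> is too large to be a proper ideal and too small to be \<open>G1\<close>.\<close>
    define L where "L a = br x a - t *\<^sub>R a" for a
    have linL: "linear L"
      unfolding L_def by (intro linear_compose_sub linear_right) (simp add: linear_scaleR)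
    have L_G1: "L a \<in> G1" if "a \<in> G1" for a
      unfolding L_def using that by (intro subspace_diff subspace_scale subspace_G1 br_G1)
    have L_M: "L a \<in> G2" if "a \<in> M" for a
    proof (rule linear_image_span_subset[OF linL _ subspace_G2])
      show "a \<in> span (insert m G2)" using that Mspan by blast
      show "L b \<in> G2" if "b \<in> insert m G2" for b
        using that t unfolding L_def
        by (auto intro!: subspace_diff subspace_scale subspace_G2 ideal_right[OF ideal_G2])
    qed
    let ?I = "{L a + z | a z. a \<in> G1 \<and> z \<in> G2}"
    have I: "ideal ?I"
      unfolding ideal_def
    proof (intro conjI allI ballI)
      have "subspace {p + z | p z. p \<in> L ` G1 \<and> z \<in> G2}"
        by (intro subspace_sums linear_subspace_image linL subspace_G1 subspace_G2)
      also have "{p + z | p z. p \<in> L ` G1 \<and> z \<in> G2} = ?I" by blast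
      finally show "subspace ?I" .
      show "br g p \<in> ?I" if p: "p \<in> ?I" for g p
      proof -
        obtain a z where a: "a \<in> G1" "z \<in> G2" "p = L a + z" using p by blast
        have "br g p = L (br g a) + (br (br g x) a + br g z)"
          unfolding a(3) L_def by (simp add: br_simps jacobi[of g x a])
        moreover have "br (br g x) a + br g z \<in> G2"
          by (intro subspace_add subspace_G2 br_G2 br_G1 a ideal_right[OF ideal_G2])
        ultimately show ?thesis by blast
      qed
    qed
    have IG1: "?I \<subseteq> G1"
      using L_G1 G2_subset_G1 subspace_add[OF subspace_G1] by blast
    \<comment> \<open>As \<open>L\<close> maps \<open>M\<close> into \<open>G2\<close>, the
      dimension of \<open>?I\<close> is at most \<open>4 + 1 - 2 = 3\<close>. So \<open>?I\<close>
      is proper, and the bound lowers this to 2.\<close>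
    have "dim {s \<in> G1. L s \<in> G2} + dim ?I = dim G1 + dim G2"
      by (rule dim_preimage_image[OF linL subspace_G1 subspace_G2])
    moreover have "dim M \<le> dim {s \<in> G1. L s \<in> G2}"
      by (rule dim_subset) (use L_M M in blast)
    ultimately have "dim ?I \<le> 3" using four M_eq dim_G2 by linarith
    then have "?I \<noteq> G1" using four by auto
    then have I2: "dim ?I \<le> 2" using dim_ideal_le_2[OF I IG1] by blast
    \<comment> \<open>\<open>?J\<close> is larger than \<open>M\<close>, hence all of
      \<open>G1\<close>; but its summands have dimension at most 2 and share the line
      \<open>G2\<close>, so 4 is out of reach.\<close>
    let ?J = "{p + q | p q. p \<in> ?I \<and> q \<in> M}"
    have J: "ideal ?J" by (rule ideal_sums[OF I M(1)])
    have "0 \<in> ?I" using I unfolding ideal_def by (intro subspace_0) blast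
    have "0 \<in> M" using subspace_M by (rule subspace_0)
    have "M \<subseteq> ?J"
    proof
      fix q assume "q \<in> M"
      then have "0 + q \<in> ?J" using \<open>0 \<in> ?I\<close> by blast
      then show "q \<in> ?J" by simp
    qed
    moreover have "?J \<subseteq> G1" using IG1 M(3) subspace_add[OF subspace_G1] by blast
    ultimately have "?J = M \<or> ?J = G1"
      using J by (intro irreducible) (auto simp: ideal_def)
    moreover have "?J \<noteq> M"
    proof -
      obtain a where a: "a \<in> G1" "L a \<notin> M" using x unfolding L_def by blast
      have "L a + 0 \<in> ?I" using a subspace_0[OF subspace_G2] by blast
      then have "(L a + 0) + 0 \<in> ?J" using \<open>0 \<in> M\<close> by blast
      then have "L a \<in> ?J" by (simp only: add_0_right)
      then show ?thesis using a(2) by (rule_tac notI) (simp only:)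
    qed
    ultimately have "dim ?J = 4" using four by simp
    moreover have "dim ?J + dim (?I \<inter> M) = dim ?I + dim M"
      by (rule dim_sums_Int) (use I subspace_M in \<open>auto simp: ideal_def\<close>)
    moreover have "dim G2 \<le> dim (?I \<inter> M)"
    proof (rule dim_subset, rule subsetI)
      fix z assume "z \<in> G2"
      then have "L 0 + z \<in> ?I" using subspace_0[OF subspace_G1] by blast
      then show "z \<in> ?I \<inter> M" using M \<open>z \<in> G2\<close> by (auto simp: linear_0[OF linL])
    qed
    ultimately show False using I2 M_eq dim_G2 by linarith
  qed
  ultimately show ?thesis using G1M M2 by linarith
qed

section \<open>The Heisenberg algebra \<open>G1\<close> and its centralizer\<close>

lemma G1_span:
  assumes "y1 \<in> G1" "y1 \<notin> G2" "y2 \<in> G1" "y2 \<notin> span (insert y1 G2)"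
  shows "G1 = span (insert y1 (insert y2 G2))" "br y1 y2 \<noteq> 0" "G2 = span {br y1 y2}"
proof -
  have sub: "span (insert y1 G2) \<subseteq> G1"
    using assms G2_subset_G1 by (intro span_minimal subspace_G1) auto
  have "dim (span (insert y1 G2)) = 2"
    using assms dim_G2 by (simp add: dim_insert span_eq_iff[THEN iffD2, OF subspace_G2])
  then have "G1 = span (insert y2 (span (insert y1 G2)))"
    using sub assms dim_G1 by (intro subspace_span_insert subspace_span subspace_G1) auto
  also have "\<dots> = span (insert y1 (insert y2 G2))"
    unfolding insert_commute[of y1 y2] set_eq_iff span_breakdown_eq[of _ y2] span_span by blast
  finally show G1: "G1 = span (insert y1 (insert y2 G2))" .
  then have G2: "G2 \<subseteq> span {br y1 y2}"
    using G1_G2_commute by (rule G2_subset_span_bracket)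
  then show "br y1 y2 \<noteq> 0" using G2_nonzero subspace_0[OF subspace_G2] by auto
  show "G2 = span {br y1 y2}"
    using G2 assms br_G2 by (intro subset_antisym span_minimal subspace_G2) auto
qed

lemma obtain_G1_span:
  assumes "y1 \<in> G1" "y1 \<notin> G2"
  obtains y2 where "y2 \<in> G1" "y2 \<notin> span (insert y1 G2)"
proof -
  have "dim (span (insert y1 G2)) = 2"
    using assms dim_G2 by (simp add: dim_insert span_eq_iff[THEN iffD2, OF subspace_G2])
  have "span (insert y1 G2) \<noteq> G1"
  proof
    assume "span (insert y1 G2) = G1"
    then have "dim G1 = 2" using \<open>dim (span (insert y1 G2)) = 2\<close> by (simp only:)
    then show False using dim_G1 by simp
  qed
  moreover have "span (insert y1 G2) \<subseteq> G1"
    using assms G2_subset_G1 by (intro span_minimal subspace_G1) auto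
  ultimately show ?thesis using that by blast
qed

lemma obtain_heisenberg:
  obtains y1 y2 where "y1 \<in> G1" "y2 \<in> G1" "G1 = span (insert y1 (insert y2 G2))"
    "br y1 y2 \<noteq> 0" "G2 = span {br y1 y2}"
proof -
  obtain y1 where y1: "y1 \<in> G1" "y1 \<notin> G2" using G2_subset_G1 G2_neq_G1 by blast
  obtain y2 where y2: "y2 \<in> G1" "y2 \<notin> span (insert y1 G2)" using obtain_G1_span[OF y1] .
  show ?thesis using that[OF y1(1) y2(1) G1_span[OF y1 y2]] .
qed

text \<open>\<open>G2\<close> is the centre of the Heisenberg algebra \<open>G1\<close>: brackets
  with \<open>y1\<close> and \<open>y2\<close> read off the coordinates modulo
  \<open>G2\<close>.\<close>

lemma centralizer_Int_G1: "centralizer \<inter> G1 = G2"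
proof
  show "G2 \<subseteq> centralizer \<inter> G1"
  proof
    fix z assume "z \<in> G2"
    then have "br z a = 0" if "a \<in> G1" for a using G1_G2_commute[OF that] by (subst br_skew) simp
    then show "z \<in> centralizer \<inter> G1" using \<open>z \<in> G2\<close> G2_subset_G1 by (auto simp: centralizer_def)
  qed
  show "centralizer \<inter> G1 \<subseteq> G2"
  proof
    fix c assume c: "c \<in> centralizer \<inter> G1"
    obtain y1 y2 where y: "y1 \<in> G1" "y2 \<in> G1" "G1 = span (insert y1 (insert y2 G2))"
      "br y1 y2 \<noteq> 0" "G2 = span {br y1 y2}" by (rule obtain_heisenberg)
    obtain k l m where m: "m \<in> G2" "c = k *\<^sub>R y1 + l *\<^sub>R y2 + m"
      using c by (auto elim: G1_decompose[OF y(3)])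
    have my: "br m y1 = 0" "br m y2 = 0"
      using G1_G2_commute[OF y(1) m(1)] G1_G2_commute[OF y(2) m(1)]
      by (simp_all add: br_skew[of m y1] br_skew[of m y2])
    have "br c y1 = 0" "br c y2 = 0" using c y(1,2) by (auto simp: centralizer_def)
    then have "l *\<^sub>R br y1 y2 = 0" "k *\<^sub>R br y1 y2 = 0"
      unfolding m(2) using my by (simp_all add: br_simps br_self br_skew[of y2 y1])
    then show "c \<in> G2" using y(4) m by simp
  qed
qed

text \<open>The centralizer is an ideal, so the bracket lies in it and in \<open>G1\<close>. This
  opens \<open>dim_le_2\<close> with \<open>I = G2\<close> to the centralizer.\<close>

lemma br_centralizer: "c \<in> centralizer \<Longrightarrow> br g c \<in> G2"
  unfolding centralizer_Int_G1[symmetric] by (intro IntI ideal_right[OF ideal_centralizer] br_G1)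

lemma dim_centralizer_le: "dim centralizer \<le> 2"
  by (rule dim_le_2[OF subspace_G2 G2_subset_G1 G2_neq_G1 subspace_centralizer br_centralizer])

lemma dim_trivial_action_le: "dim {g. \<forall>a\<in>G1. br g a \<in> G2} \<le> dim centralizer + 2"
proof -
  obtain y1 y2 where y: "y1 \<in> G1" "y2 \<in> G1" "G1 = span (insert y1 (insert y2 G2))"
    "br y1 y2 \<noteq> 0" "G2 = span {br y1 y2}" by (rule obtain_heisenberg)
  let ?z = "br y1 y2"
  have "{g. \<forall>a\<in>G1. br g a \<in> G2} \<subseteq> span (insert y1 (insert y2 centralizer))"
  proof
    fix g assume "g \<in> {g. \<forall>a\<in>G1. br g a \<in> G2}"
    then have "br g y1 \<in> span {?z}" "br g y2 \<in> span {?z}" using y(1,2,5) by blast+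
    then obtain s t where st: "br g y1 = s *\<^sub>R ?z" "br g y2 = t *\<^sub>R ?z"
      by (auto simp: span_singleton)
    \<comment> \<open>As \<open>br y2 y1 = - ?z\<close>, these coefficients cancel the brackets of
      \<open>g\<close> with \<open>y1\<close> and \<open>y2\<close>; Jacobi then disposes of
      \<open>?z\<close>.\<close>
    let ?h = "g - t *\<^sub>R y1 + s *\<^sub>R y2"
    have h: "br ?h y1 = 0" "br ?h y2 = 0"
      by (simp_all add: br_simps st br_self br_skew[of y2 y1])
    have hz: "br ?h ?z = 0"
      unfolding jacobi[of ?h y1 y2] h by (simp add: bilinear_lzero[OF bilinear_br] bilinear_rzero[OF bilinear_br])
    have "br ?h a \<in> {0}" if "a \<in> G1" for a
    proof (rule linear_image_span_subset[OF linear_right])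
      show "a \<in> span (insert y1 (insert y2 G2))" using that y by blast
      show "br ?h b \<in> {0}" if "b \<in> insert y1 (insert y2 G2)" for b
      proof -
        have "br ?h b = 0" if b: "b \<in> G2"
        proof -
          obtain k where "b = k *\<^sub>R ?z" using b y(5) by (auto simp: span_singleton)
          then show ?thesis using hz by (simp add: bilinear_rmul[OF bilinear_br])
        qed
        then show ?thesis using that h by auto
      qed
    qed simp
    then have "?h \<in> span (insert y1 (insert y2 centralizer))"
      by (intro span_base) (simp add: centralizer_def)
    then have "?h + t *\<^sub>R y1 - s *\<^sub>R y2 \<in> span (insert y1 (insert y2 centralizer))"
      by (rule span_diff[OF span_add[OF _ span_scale] span_scale]) (auto intro: span_base)
    then show "g \<in> span (insert y1 (insert y2 centralizer))" by simp
  qed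
  then have "dim {g. \<forall>a\<in>G1. br g a \<in> G2} \<le> dim (span (insert y1 (insert y2 centralizer)))"
    by (rule dim_subset)
  also have "\<dots> \<le> dim centralizer + 2" by (simp add: dim_insert)
  finally show ?thesis .
qed

section \<open>Irreducibility of \<open>G1/G2\<close> and the adapted basis\<close>

lemma irreducible_G1_mod_G2:
  assumes dim6: "DIM('a) \<ge> 6"
  shows "irreducible_commuting br G1 G2"
proof -
  obtain M where M: "ideal M" "G2 \<subseteq> M" "M \<subseteq> G1" "M \<noteq> G1" "irreducible_commuting br G1 M"
    by (rule obtain_maximal_ideal)
  have sub_M: "subspace M" using M by (simp add: ideal_def)
  have "M = G2"
  proof (rule ccontr)
    assume neq: "M \<noteq> G2"
    then obtain m where m: "m \<in> M" "m \<notin> G2" using M by blast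
    have "dim M \<le> 2" using M dim_ideal_le_2 by blast
    moreover have "\<not> dim M \<le> dim G2" using subspace_dim_equal[OF subspace_G2 sub_M M(2)] neq by auto
    ultimately have M2: "dim M = 2" using dim_G2 by simp
    have Mspan: "M = span (insert m G2)"
      by (rule subspace_span_insert[OF subspace_G2 sub_M M(2) m]) (use M2 dim_G2 in simp)
    \<comment> \<open>Brackets with \<open>?S\<close> stay in \<open>M\<close>, so the bound forces
      the centralizer into \<open>M\<close>, hence into \<open>G2\<close>.\<close>
    let ?S = "{x + y | x y. x \<in> M \<and> y \<in> centralizer}"
    have sub_S: "subspace ?S" by (intro subspace_sums sub_M subspace_centralizer)
    have "dim ?S \<le> 2"
    proof (rule dim_le_2[OF sub_M M(3,4) sub_S])
      fix s g assume "s \<in> ?S"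
      then obtain x y where xy: "x \<in> M" "y \<in> centralizer" "s = x + y" by blast
      have "br g x + br g y \<in> M"
        by (intro subspace_add[OF sub_M] ideal_right[OF M(1)] M(2)[THEN subsetD] br_centralizer xy)
      then show "br g s \<in> M" using xy by (simp add: br_simps)
    qed
    moreover have "M \<subseteq> ?S"
    proof
      fix x assume "x \<in> M"
      then have "x + 0 \<in> ?S" using subspace_0[OF subspace_centralizer] by blast
      then show "x \<in> ?S" by simp
    qed
    ultimately have SM: "M = ?S" using M2 by (intro subspace_dim_equal sub_M sub_S) auto
    have "centralizer \<subseteq> M"
    proof
      fix y assume "y \<in> centralizer"
      then have "0 + y \<in> ?S" using subspace_0[OF sub_M] by blast
      then show "y \<in> M" using SM by simp
    qed
    then have "centralizer \<subseteq> G2" using M(3) centralizer_Int_G1 by blast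
    then have "dim centralizer \<le> 1" using dim_subset dim_G2 by metis
    then have K: "dim {g. \<forall>a\<in>G1. br g a \<in> G2} \<le> 3" using dim_trivial_action_le by linarith
    \<comment> \<open>The elements acting trivially on \<open>M/G2\<close>. Brackets with
      \<open>m\<close> stay in the plane \<open>M\<close>, so their dimension is at least
      \<open>6 + 1 - 2\<close>.\<close>
    let ?H = "{g \<in> UNIV. br g m \<in> G2}"
    have sub_H: "subspace ?H" using subspace_G2 by (auto simp: subspace_def br_simps)
    have "dim ?H + dim {br g m + z | g z. g \<in> UNIV \<and> z \<in> G2} = dim (UNIV :: 'a set) + dim G2"
      by (rule dim_preimage_image[OF linear_left subspace_UNIV subspace_G2])
    moreover have "dim {br g m + z | g z. g \<in> UNIV \<and> z \<in> G2} \<le> dim M"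
      by (rule dim_subset) (use m M in \<open>auto intro!: subspace_add[OF sub_M] ideal_right\<close>)
    ultimately have H: "dim ?H \<ge> 5" using dim6 M2 dim_G2 by simp
    obtain y where y: "y \<in> G1" "y \<notin> M" using M by blast
    have G1y: "G1 = span (insert y M)"
      by (rule subspace_span_insert[OF sub_M subspace_G1 M(3) y]) (use M2 dim_G1 in simp)
    \<comment> \<open>The count \<open>5 + 1 - 3\<close> makes \<open>?I\<close> all of
      \<open>G1\<close>.\<close>
    let ?I = "{br g y + z | g z. g \<in> ?H \<and> z \<in> G2}"
    have "dim {g \<in> ?H. br g y \<in> G2} + dim ?I = dim ?H + dim G2"
      by (rule dim_preimage_image[OF linear_left sub_H subspace_G2])
    moreover have "dim {g \<in> ?H. br g y \<in> G2} \<le> dim {g. \<forall>a\<in>G1. br g a \<in> G2}"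
    proof (rule dim_subset, intro subsetI CollectI ballI)
      fix g a assume g: "g \<in> {g \<in> ?H. br g y \<in> G2}" and a: "a \<in> G1"
      have gM: "br g b \<in> G2" if "b \<in> M" for b
        by (rule linear_image_span_subset[OF linear_right _ subspace_G2])
          (use that Mspan g ideal_right[OF ideal_G2] in auto)
      show "br g a \<in> G2"
        by (rule linear_image_span_subset[OF linear_right _ subspace_G2])
          (use a G1y g gM in auto)
    qed
    ultimately have "dim ?I \<ge> dim G1" using H K dim_G1 dim_G2 by linarith
    moreover have "subspace ?I"
    proof -
      have "subspace {p + z | p z. p \<in> (\<lambda>g. br g y) ` ?H \<and> z \<in> G2}"
        by (intro subspace_sums linear_subspace_image linear_left sub_H subspace_G2)
      also have "{p + z | p z. p \<in> (\<lambda>g. br g y) ` ?H \<and> z \<in> G2} = ?I" by blast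
      finally show ?thesis .
    qed
    moreover have "?I \<subseteq> G1" using G2_subset_G1 by (auto intro!: subspace_add[OF subspace_G1])
    ultimately have "?I = G1" using subspace_G1 by (intro subspace_dim_equal)
    \<comment> \<open>Modulo \<open>G2\<close>, \<open>g\<close> fixes \<open>y\<close> and kills
      \<open>m\<close>, while \<open>h\<close> sends \<open>y\<close> to \<open>m\<close>. Their
      actions must commute there, which puts \<open>m\<close> in \<open>G2\<close>.\<close>
    then have "y \<in> ?I" "m \<in> ?I" using y m M by auto
    then obtain g z h z' where gh: "br g m \<in> G2" "z \<in> G2" "z' \<in> G2"
      "y = br g y + z" "m = br h y + z'" by blast
    have "br h (br g y) - br g (br h y) \<in> G2"
      using y by (simp add: br_commutator br_G2 br_G1)
    moreover have "br g y = y - z" "br h y = m - z'" using gh(4,5) by (simp_all add: eq_diff_eq)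
    ultimately have "(m - z' - br h z) - (br g m - br g z') \<in> G2" by (simp add: br_simps)
    moreover have "z' + br h z + (br g m - br g z') \<in> G2"
      by (intro subspace_add subspace_diff subspace_G2 gh ideal_right[OF ideal_G2])
    ultimately have "(m - z' - br h z) - (br g m - br g z') + (z' + br h z + (br g m - br g z')) \<in> G2"
      by (rule subspace_add[OF subspace_G2])
    then show False using m by simp
  qed
  then show ?thesis using M by simp
qed

lemma isomorphic_to_R_s545:
  assumes dim6: "DIM('a) \<ge> 6"
  shows "lie_isomorphic_to_R_s545 br \<and> DIM('a) = 6"
proof -
  interpret irreducible_commuting br G1 G2 by (rule irreducible_G1_mod_G2[OF dim6])
  note closed = subspace_add[OF subspace_G2] subspace_diff[OF subspace_G2] subspace_scale[OF subspace_G2]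
    ideal_right[OF ideal_G2]
  obtain y where y: "y \<in> G1" "y \<notin> G2" using G2_subset_G1 G2_neq_G1 by blast
  let ?K = "{g \<in> UNIV. br g y \<in> G2}" and ?I = "{br g y + z | g z. g \<in> UNIV \<and> z \<in> G2}"
  have dims: "dim ?K + dim ?I = DIM('a) + 1"
    using dim_preimage_image[OF linear_left subspace_UNIV subspace_G2, of y] dim_G2 by simp
  \<comment> \<open>By \<open>schur\<close>, an element moving \<open>y\<close> into
    \<open>G2\<close> acts trivially on \<open>G1/G2\<close>.\<close>
  have "?K \<subseteq> {g. \<forall>a\<in>G1. br g a \<in> G2}"
    using schur[OF equivariant_T y] by blast
  then have K: "dim ?K \<le> dim centralizer + 2"
    using dim_trivial_action_le dim_subset order_trans by blast
  have I_sub: "?I \<subseteq> G1" using G2_subset_G1 by (auto intro!: subspace_add[OF subspace_G1])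
  have I_le: "dim ?I \<le> 3" using dim_subset[OF I_sub] dim_G1 by simp
  \<comment> \<open>The dimensions of \<open>?K\<close> and \<open>?I\<close> are at most 4 and 3
    but add up to at least 7, so every estimate is an equality.\<close>
  have n: "DIM('a) = 6" and C: "dim centralizer = 2" and I_eq: "dim ?I = 3"
    using dims K I_le dim6 dim_centralizer_le by linarith+
  have sub_I: "subspace ?I"
  proof -
    have "subspace {p + z | p z. p \<in> range (\<lambda>g. br g y) \<and> z \<in> G2}"
      by (intro subspace_sums linear_subspace_image linear_left subspace_UNIV subspace_G2)
    also have "{p + z | p z. p \<in> range (\<lambda>g. br g y) \<and> z \<in> G2} = ?I" by blast
    finally show ?thesis .
  qed
  have IG1: "?I = G1"
    by (rule subspace_dim_equal[OF sub_I subspace_G1 I_sub]) (use I_eq dim_G1 in simp)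
  have onto: "\<exists>g. br g y - a \<in> G2" if "a \<in> G1" for a
  proof -
    have "a \<in> ?I" using that IG1 by simp
    then obtain g z where "z \<in> G2" "a = br g y + z" by blast
    then have "br g y - a \<in> G2" using subspace_neg[OF subspace_G2] by auto
    then show ?thesis ..
  qed

  obtain x1 where "br x1 y - y \<in> G2" using onto y by blast
  then have x1: "br x1 a - a \<in> G2" if "a \<in> G1" for a
    using schur[where L = "\<lambda>a. br x1 a - 1 *\<^sub>R a", OF _ y _ that]
      equivariant_diff[OF equivariant_T equivariant_scale[of 1]] by simp
  \<comment> \<open>An element sending \<open>y\<close> to a vector independent of \<open>y\<close>
    modulo \<open>G2\<close> cannot act by a scalar.\<close>
  obtain w where w: "w \<in> G1" "w \<notin> span (insert y G2)" using obtain_G1_span[OF y] .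
  obtain x0 where x0: "br x0 y - w \<in> G2" using onto w by blast
  obtain p q where pq: "q \<noteq> 0"
    "\<And>a. a \<in> G1 \<Longrightarrow> br x0 (br x0 a) - (2 * p) *\<^sub>R br x0 a + (p\<^sup>2 + q\<^sup>2) *\<^sub>R a \<in> G2"
  proof (cases rule: scalar_or_quadratic[of x0])
    case (1 t)
    have "(br x0 y - t *\<^sub>R y) - (br x0 y - w) \<in> G2" by (intro closed 1 y x0)
    then have "w - t *\<^sub>R y \<in> G2" by simp
    then have "w \<in> span (insert y G2)" using span_base by (auto simp: span_breakdown_eq)
    then show ?thesis using w by simp
  next
    case (2 q p)
    then show ?thesis using that by blast
  qed
  \<comment> \<open>Completing the square: on \<open>G1/G2\<close>, \<open>x1\<close> is the
    identity, so \<open>x0 - p *\<^sub>R x1\<close> squares to \<open>- q^2\<close> and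
    \<open>x2\<close> acts as an imaginary unit.\<close>
  define x2 where "x2 = (1 / q) *\<^sub>R (x0 - p *\<^sub>R x1)"
  have x2: "br x2 (br x2 a) + a \<in> G2" if a: "a \<in> G1" for a
  proof -
    let ?X = "x0 - p *\<^sub>R x1"
    let ?b = "br ?X a"
    let ?u = "br x0 (br x0 a) - (2 * p) *\<^sub>R br x0 a + (p\<^sup>2 + q\<^sup>2) *\<^sub>R a"
    have two: "(2 * r) *\<^sub>R x = r *\<^sub>R x + r *\<^sub>R x" for r and x :: 'a
      by (metis mult_2 scaleR_left_distrib)
    have "br ?X ?b + q\<^sup>2 *\<^sub>R a =
        ?u + p\<^sup>2 *\<^sub>R (br x1 a - a) - p *\<^sub>R br x0 (br x1 a - a) - p *\<^sub>R (br x1 ?b - ?b)"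
      unfolding two by (simp add: br_simps algebra_simps power2_eq_square)
    also have "\<dots> \<in> G2" by (intro closed(1,2,3) closed(4) pq x1 a br_G1)
    finally have "(1 / q\<^sup>2) *\<^sub>R (br ?X ?b + q\<^sup>2 *\<^sub>R a) \<in> G2" by (rule closed(3))
    moreover have "(1 / q\<^sup>2) *\<^sub>R (br ?X ?b + q\<^sup>2 *\<^sub>R a) = br x2 (br x2 a) + a"
      using pq(1) unfolding x2_def bilinear_lmul[OF bilinear_br] bilinear_rmul[OF bilinear_br]
      by (simp add: scaleR_right_distrib power2_eq_square)
    ultimately show ?thesis by simp
  qed

  \<comment> \<open>\<open>br x1\<close> is a derivation acting as 1 on \<open>G1/G2\<close>, so it
    acts as \<open>1 + 1\<close> on brackets of \<open>G1\<close>.\<close>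
  have x1_G2: "br x1 z = 2 *\<^sub>R z" if "z \<in> G2" for z
  proof -
    have "G2 \<subseteq> {z. br x1 z = 2 *\<^sub>R z}"
    proof (rule G2_minimal)
      show "subspace {z. br x1 z = 2 *\<^sub>R z}" by (auto simp: subspace_def br_simps algebra_simps)
      fix a b assume ab: "a \<in> G1" "b \<in> G1"
      have "br (br x1 a - a) b = - br b (br x1 a - a)" by (rule br_skew)
      then have "br (br x1 a - a) b = 0" "br a (br x1 b - b) = 0"
        using G1_G2_commute x1 ab by simp_all
      then have "br (br x1 a) b = br a b" "br a (br x1 b) = br a b" by (simp_all add: br_simps)
      then show "br a b \<in> {z. br x1 z = 2 *\<^sub>R z}" by (simp add: jacobi[of x1 a b] scaleR_2)
    qed
    then show ?thesis using that by blast
  qed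

  \<comment> \<open>\<open>y1\<close> is \<open>y\<close> minus the error
    \<open>br x1 y - y\<close>, which lies in \<open>G2\<close> and is doubled by \<open>x1\<close>;
    this makes \<open>y1\<close> an exact eigenvector.\<close>
  define y1 where "y1 = 2 *\<^sub>R y - br x1 y"
  have x1y1: "br x1 y1 = y1"
  proof -
    have "br x1 (br x1 y - y) = 2 *\<^sub>R (br x1 y - y)" using x1_G2 x1 y by blast
    then show ?thesis unfolding y1_def by (simp add: br_simps algebra_simps scaleR_2)
  qed
  have y1: "y1 \<in> G1" unfolding y1_def by (intro subspace_diff subspace_scale subspace_G1 y br_G1)
  have "y1 \<notin> G2"
  proof
    assume "y1 \<in> G2"
    then have "y1 + (br x1 y - y) \<in> G2" using closed(1) x1 y(1) by blast
    then show False using y by (simp add: y1_def scaleR_2)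
  qed

  \<comment> \<open>The element \<open>u - (1/2) *\<^sub>R (br x1 u - u)\<close> of
    \<open>G1\<close> is sent to \<open>u\<close> by \<open>x1\<close>. Subtracting it makes
    \<open>x2'\<close> commute with \<open>x1\<close> and does not change the action on
    \<open>G1/G2\<close>.\<close>
  define u where "u = br x1 x2"
  define x2' where "x2' = x2 - u + (1/2) *\<^sub>R (br x1 u - u)"
  have uG: "u \<in> G1" unfolding u_def by (rule br_G1)
  have x1x2: "br x1 x2' = 0"
  proof -
    have "br x1 (br x1 u - u) = 2 *\<^sub>R (br x1 u - u)" using x1_G2 x1 uG by blast
    then have "br x1 ((1/2) *\<^sub>R (br x1 u - u)) = br x1 u - u"
      by (simp add: bilinear_rmul[OF bilinear_br])
    then show ?thesis unfolding x2'_def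
      by (simp add: bilinear_radd[OF bilinear_br] bilinear_rsub[OF bilinear_br, of x1 x2 u] u_def[symmetric])
  qed
  have x2': "br x2' a - br x2 a \<in> G2" if "a \<in> G1" for a
  proof -
    have "- u + (1/2) *\<^sub>R (br x1 u - u) \<in> G1"
      by (intro subspace_add subspace_diff subspace_scale subspace_neg subspace_G1 uG br_G1)
    then have "br (- u + (1/2) *\<^sub>R (br x1 u - u)) a \<in> G2" using that by (rule br_G2)
    moreover have "br x2' a - br x2 a = br (- u + (1/2) *\<^sub>R (br x1 u - u)) a"
      unfolding x2'_def by (simp add: br_simps)
    ultimately show ?thesis by simp
  qed
  have x2'_sq: "br x2' (br x2' a) + a \<in> G2" if a: "a \<in> G1" for a
  proof -
    have "br x2' (br x2' a) - br x2 (br x2' a) + br x2 (br x2' a - br x2 a) + (br x2 (br x2 a) + a) \<in> G2"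
      by (rule closed(1)[OF closed(1)[OF x2' closed(4)] x2]) (auto intro: x2' a)
    then show ?thesis by (simp add: br_simps)
  qed
  define y2 where "y2 = br x2' y1"
  have y2: "y2 \<in> G1" unfolding y2_def by (rule br_G1)
  have x1y2: "br x1 y2 = y2"
    unfolding y2_def using jacobi[of x1 x2' y1] by (simp add: x1x2 x1y1 br_simps)
  \<comment> \<open>The error \<open>?e\<close> lies in \<open>G2\<close>, where \<open>x1\<close>
    acts as 2; since \<open>x1\<close> and \<open>x2'\<close> commute, \<open>x1\<close> also fixes
    \<open>?e\<close>.\<close>
  have x2y2: "br x2' y2 = - y1"
  proof -
    let ?e = "br x2' y2 + y1"
    have "?e \<in> G2" unfolding y2_def by (rule x2'_sq[OF y1])
    then have "br x1 ?e = 2 *\<^sub>R ?e" by (rule x1_G2)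
    moreover have "br x1 ?e = ?e"
      using jacobi[of x1 x2' y2] by (simp add: x1x2 x1y1 x1y2 br_simps)
    ultimately have "?e = 0" by (simp add: scaleR_2)
    then show ?thesis by (simp add: eq_neg_iff_add_eq_0)
  qed
  have y2_notin: "y2 \<notin> span (insert y1 G2)"
  proof
    assume "y2 \<in> span (insert y1 G2)"
    then obtain t where t: "y2 - t *\<^sub>R y1 \<in> G2"
      using span_eq_iff[THEN iffD2, OF subspace_G2] by (auto simp: span_breakdown_eq)
    \<comment> \<open>Applying \<open>x2'\<close> to \<open>y2 = t y1\<close> modulo
      \<open>G2\<close> would give \<open>t^2 = -1\<close>.\<close>
    have "(-1) *\<^sub>R (br x2' (y2 - t *\<^sub>R y1)) - t *\<^sub>R (y2 - t *\<^sub>R y1) \<in> G2"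
      by (rule closed(2)[OF closed(3)[OF closed(4)[OF t]] closed(3)[OF t]])
    also have "(-1) *\<^sub>R (br x2' (y2 - t *\<^sub>R y1)) - t *\<^sub>R (y2 - t *\<^sub>R y1) = (1 + t\<^sup>2) *\<^sub>R y1"
      by (simp add: br_simps x2y2 y2_def[symmetric] algebra_simps power2_eq_square)
    finally have "(1 / (1 + t\<^sup>2)) *\<^sub>R ((1 + t\<^sup>2) *\<^sub>R y1) \<in> G2" by (rule closed(3))
    moreover have "1 + t\<^sup>2 \<noteq> 0" by (metis add_pos_nonneg less_irrefl zero_le_power2 zero_less_one)
    ultimately show False using \<open>y1 \<notin> G2\<close> by simp
  qed
  define z where "z = br y1 y2"
  have z: "z \<noteq> 0" "G2 = span {z}" "z \<in> G2"
    unfolding z_def using G1_span[OF y1 \<open>y1 \<notin> G2\<close> y2 y2_notin] br_G2 y1 y2 by auto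
  have x2z: "br x2' z = 0"
    unfolding z_def by (subst jacobi) (simp add: x2y2 y2_def[symmetric] br_simps br_self)

  have "\<not> centralizer \<subseteq> G2"
    using C dim_G2 dim_subset[of centralizer G2] by auto
  then obtain c0 where c0: "c0 \<in> centralizer" "c0 \<notin> G2" by blast
  \<comment> \<open>\<open>x1\<close> doubles \<open>br x1 c0\<close>, so subtracting half of it
    makes \<open>c\<close> commute with \<open>x1\<close>.\<close>
  define c where "c = c0 - (1/2) *\<^sub>R br x1 c0"
  have c0G: "br x1 c0 \<in> G2" by (rule br_centralizer[OF c0(1)])
  have cC: "c \<in> centralizer"
    unfolding c_def using c0 c0G centralizer_Int_G1
    by (intro subspace_diff subspace_scale subspace_centralizer) auto
  have cG2: "c \<notin> G2"
  proof
    assume "c \<in> G2"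
    then have "c + (1/2) *\<^sub>R br x1 c0 \<in> G2" using c0G by (intro closed(1,3))
    then show False using c0 by (simp add: c_def)
  qed
  have x1c: "br x1 c = 0"
    unfolding c_def by (simp add: br_simps x1_G2[OF c0G])
  \<comment> \<open>\<open>x1\<close> commutes with \<open>x2'\<close> and \<open>c\<close>, so it
    kills their bracket, yet doubles it as an element of \<open>G2\<close>.\<close>
  have x2c: "br x2' c = 0"
  proof -
    have "br x1 (br x2' c) = 2 *\<^sub>R br x2' c" using x1_G2 br_centralizer cC by blast
    moreover have "br x1 (br x2' c) = 0" using jacobi[of x1 x2' c] by (simp add: x1x2 x1c br_simps)
    ultimately show ?thesis by simp
  qed
  have cG1: "br c a = 0" if "a \<in> G1" for a using cC that by (simp add: centralizer_def)
  have "lie_isomorphic_to_R_s545 br"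
  proof (rule lie_isomorphic_to_R_s545I[of x1 x2' y1 y2 z c])
    show "br c x1 = 0" "br c x2' = 0" using x1c x2c by (simp_all add: br_skew[of c])
    show "br c y1 = 0" "br c y2 = 0" "br c z = 0" using cG1 y1 y2 z G2_subset_G1 by auto
    show "br y1 z = 0" "br y2 z = 0" using G1_G2_commute y1 y2 z by auto
    show "c \<notin> span {z}" using cG2 z by simp
  qed (use x1x2 x1y1 x1y2 x1_G2 x2y2 x2z z n in \<open>auto simp: y2_def z_def\<close>)
  then show ?thesis using n by simp
qed

end

theorem theorem5p1:
  fixes br :: "'a::euclidean_space \<Rightarrow> 'a \<Rightarrow> 'a"
  assumes "DIM('a) \<ge> 6"
    and "two_step_solvable br"
    and "MD_algebra (DIM('a) - 2) br"
  shows "lie_isomorphic_to_R_s545 br \<and> DIM('a) = 6"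
proof -
  interpret lie br using assms(3) by unfold_locales (simp add: MD_algebra_def)
  interpret md_lie br
  proof
    show "dim S \<le> 2" if "subspace I" "I \<subseteq> G1" "I \<noteq> G1" "\<And>s y. s \<in> S \<Longrightarrow> br y s \<in> I" for I S
      using MD_algebra_dim_le_2[OF assms(3), of I S] assms(1) that unfolding G1_def by simp
    show "br x y = 0" if "x \<in> G2" "y \<in> G2" for x y
      using assms(2) that unfolding two_step_solvable_def G2_def by blast
    show "G2 \<noteq> {0}"
      using assms(2) unfolding two_step_solvable_def G2_def by blast
  qed
  show ?thesis using assms(1) by (rule isomorphic_to_R_s545)
qed
end
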